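(* Let $\rho$ be a Gaussian state (pure or mixed) on a bipartite system $MN$ with $|M|=m$ and $|N|=n$ modes. Then $\rho$ is a Gaussian core state if and only if its Ab parameters, written in mode-wise order, have the block form $$A_\rho=\begin{bmatrix}0&\ast\\ \ast&\ast\end{bmatrix},\qquad b_\rho=\begin{bmatrix}0\\ \ast\end{bmatrix},$$ where the first block corresponds to the $2m$ variables of $M$ and the second to the $2n$ variables of $N$, and $\ast$ denotes unconstrained blocks. Moreover, if $\rho$ is a Gaussian core state, then for every $k\in\mathbb N^n$ the stellar rank of the post-selected state $$(\mathbb 1\otimes\langle k|)\,\rho\,(\mathbb 1\otimes|k\rangle)$$ is at most $\|k\|_1$, the total number of measured photons.
   Context: For $z\in\mathbb C^p$, $|z\rangle$ denotes the $p$-mode coherent state. The Bargmann function of an operator $\rho$ on $MN$ is $F_\rho=e^{(\|z\|^2+\|w\|^2)/2}\langle z^*|\rho|w\rangle$ with $z=(z_M,z_N)$, $w=(w_M,w_N)$; in mode-wise order its variables are $\zeta=(w_M,z_M,w_N,z_N)$. $\rho$ is Gaussian if $F_\rho=c_\rho\exp(\tfrac12\zeta^{\mathrm T}A_\rho\zeta+\zeta^{\mathrm T}b_\rho)$ with $A_\rho$ complex symmetric; $(A_\rho,b_\rho)$ are its Ab parameters. A Gaussian state is a Gaussian density operator. Gaussian core state: a Gaussian state $\rho$ over $MN$ such that for all $k_1,k_2\in\mathbb N^n$ the operator $(\mathbb 1_M\otimes\langle k_1|_N)\rho(\mathbb 1_M\otimes|k_2\rangle_N)$ has finite support in the Fock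 basis of $M$, where $|k\rangle$ are $n$-mode Fock states. $\|k\|_1=\sum_ik_i$. Stellar rank: for a pure $m$-mode state whose Bargmann (stellar) function $F_{|\phi\rangle}(z)=e^{\|z\|^2/2}\langle z^*|\phi\rangle$ is a polynomial times a Gaussian function (exponential of a polynomial of degree at most two), it is the degree of the polynomial, and it is $+\infty$ otherwise; for a mixed state it is the infimum, over all decompositions into pure states, of the supremum of the stellar ranks of the pure states in the decomposition. For unnormalized nonzero positive operators it is that of the normalized state (nothing is claimed if the operator is zero). *)

theory Defs
  imports "HOL-Analysis.Analysis" "HOL-Library.Poly_Mapping" "HOL-Library.Extended_Nat"
begin

text \<open>The modes of a system are the elements of a finite type \<open>'p\<close>, its Fock basis is indexed by
  the occupation numbers \<open>'p \<Rightarrow> nat\<close>, and its Hilbert space is \<open>ell2\<close> over that index set.  A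
  system composed of \<open>'m\<close> and \<open>'n\<close> has the modes \<open>'m + 'n\<close>.  An operator is a function on
  coordinate sequences, of which only the values on \<open>ell2\<close> matter.\<close>

definition ell2 :: "('a \<Rightarrow> complex) set" where
  "ell2 = {\<psi>. (\<lambda>x. (cmod (\<psi> x))\<^sup>2) summable_on UNIV}"

definition braket :: "('a \<Rightarrow> complex) \<Rightarrow> ('a \<Rightarrow> complex) \<Rightarrow> complex" where
  "braket \<phi> \<psi> = (\<Sum>\<^sub>\<infinity>x. cnj (\<phi> x) * \<psi> x)"

definition ell2_norm :: "('a \<Rightarrow> complex) \<Rightarrow> real" where
  "ell2_norm \<psi> = sqrt (\<Sum>\<^sub>\<infinity>x. (cmod (\<psi> x))\<^sup>2)"

type_synonym 'a operator = "('a \<Rightarrow> complex) \<Rightarrow> ('a \<Rightarrow> complex)"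

definition bounded_operator :: "'a operator \<Rightarrow> bool" where
  "bounded_operator T \<longleftrightarrow>
     (\<forall>\<psi>\<in>ell2. T \<psi> \<in> ell2) \<and>
     (\<forall>\<phi>\<in>ell2. \<forall>\<psi>\<in>ell2. T (\<lambda>x. \<phi> x + \<psi> x) = (\<lambda>x. T \<phi> x + T \<psi> x)) \<and>
     (\<forall>c. \<forall>\<psi>\<in>ell2. T (\<lambda>x. c * \<psi> x) = (\<lambda>x. c * T \<psi> x)) \<and>
     (\<exists>B. \<forall>\<psi>\<in>ell2. ell2_norm (T \<psi>) \<le> B * ell2_norm \<psi>)"

definition positive_operator :: "'a operator \<Rightarrow> bool" where
  "positive_operator T \<longleftrightarrow> bounded_operator T \<and> (\<forall>\<psi>\<in>ell2. braket \<psi> (T \<psi>) \<in> \<real>\<^sub>\<ge>\<^sub>0)"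

definition basis_ket :: "'a \<Rightarrow> 'a \<Rightarrow> complex" where
  "basis_ket a = (\<lambda>x. if x = a then 1 else 0)"

text \<open>A positive bounded operator is trace class iff its diagonal in one orthonormal basis is
  summable, so no separate trace-class condition is needed.\<close>

definition density_operator :: "'a operator \<Rightarrow> bool" where
  "density_operator \<rho> \<longleftrightarrow> positive_operator \<rho> \<and>
     ((\<lambda>a. braket (basis_ket a) (\<rho> (basis_ket a))) has_sum 1) UNIV"

definition op_trace :: "'a operator \<Rightarrow> complex" where
  "op_trace T = (\<Sum>\<^sub>\<infinity>a. braket (basis_ket a) (T (basis_ket a)))"

definition normalized :: "'a operator \<Rightarrow> 'a operator" where
  "normalized T = (\<lambda>\<psi> x. T \<psi> x / op_trace T)"

definition coherent :: "complex ^ 'p::finite \<Rightarrow> ('p \<Rightarrow> nat) \<Rightarrow> complex" where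
  "coherent z = (\<lambda>k. of_real (exp (- (norm z)\<^sup>2 / 2)) *
                     (\<Prod>i\<in>UNIV. (z $ i) ^ k i / of_real (sqrt (fact (k i)))))"

definition vec_cnj :: "complex ^ 'p::finite \<Rightarrow> complex ^ 'p" where
  "vec_cnj z = (\<chi> i. cnj (z $ i))"

definition bargmann_op ::
    "('p::finite \<Rightarrow> nat) operator \<Rightarrow> complex ^ 'p \<Rightarrow> complex ^ 'p \<Rightarrow> complex" where
  "bargmann_op \<rho> z w = of_real (exp (((norm z)\<^sup>2 + (norm w)\<^sup>2) / 2)) *
     braket (coherent (vec_cnj z)) (\<rho> (coherent w))"

definition bargmann_ket :: "(('p::finite \<Rightarrow> nat) \<Rightarrow> complex) \<Rightarrow> complex ^ 'p \<Rightarrow> complex" where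
  "bargmann_ket \<phi> z = of_real (exp ((norm z)\<^sup>2 / 2)) * braket (coherent (vec_cnj z)) \<phi>"

text \<open>Mode-wise order \<open>\<zeta> = (w\<^sub>M, z\<^sub>M, w\<^sub>N, z\<^sub>N)\<close>: the index block \<open>Inl\<close> belongs to \<open>M\<close>, the block
  \<open>Inr\<close> to \<open>N\<close>.\<close>

definition mode_wise ::
    "complex ^ ('m::finite + 'n::finite) \<Rightarrow> complex ^ ('m + 'n) \<Rightarrow>
     complex ^ (('m + 'm) + ('n + 'n))" where
  "mode_wise z w = (\<chi> s. case s of
       Inl (Inl i) \<Rightarrow> w $ Inl i | Inl (Inr i) \<Rightarrow> z $ Inl i
     | Inr (Inl j) \<Rightarrow> w $ Inr j | Inr (Inr j) \<Rightarrow> z $ Inr j)"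

text \<open>The library's inner product on \<open>complex ^ 'p\<close> is real-valued; this one is bilinear over the
  complex numbers, without conjugation.\<close>

definition cdot :: "complex ^ 'p::finite \<Rightarrow> complex ^ 'p \<Rightarrow> complex" where
  "cdot x y = (\<Sum>i\<in>UNIV. x $ i * y $ i)"

definition is_Ab_parameters ::
    "('m::finite + 'n::finite \<Rightarrow> nat) operator \<Rightarrow>
     complex ^ (('m + 'm) + ('n + 'n)) ^ (('m + 'm) + ('n + 'n)) \<Rightarrow>
     complex ^ (('m + 'm) + ('n + 'n)) \<Rightarrow> bool" where
  "is_Ab_parameters \<rho> A b \<longleftrightarrow> transpose A = A \<and>
     (\<exists>c. \<forall>z w. bargmann_op \<rho> z w =
        c * exp (cdot (mode_wise z w) (A *v mode_wise z w) / 2 + cdot (mode_wise z w) b))"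

definition gaussian_state :: "('m::finite + 'n::finite \<Rightarrow> nat) operator \<Rightarrow> bool" where
  "gaussian_state \<rho> \<longleftrightarrow> density_operator \<rho> \<and> (\<exists>A b. is_Ab_parameters \<rho> A b)"

text \<open>\<open>append_fock \<psi> k\<close> is the vector \<open>\<psi> \<otimes> |k\<rangle>\<close>, and \<open>post_select k1 k2 \<rho>\<close> is the operator
  \<open>(1 \<otimes> \<langle>k1|) \<rho> (1 \<otimes> |k2\<rangle>)\<close> on the first subsystem.\<close>

definition append_fock ::
    "(('m \<Rightarrow> nat) \<Rightarrow> complex) \<Rightarrow> ('n \<Rightarrow> nat) \<Rightarrow> ('m + 'n \<Rightarrow> nat) \<Rightarrow> complex" where
  "append_fock \<psi> k = (\<lambda>x. \<psi> (x \<circ> Inl) * basis_ket k (x \<circ> Inr))"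

definition post_select ::
    "('n \<Rightarrow> nat) \<Rightarrow> ('n \<Rightarrow> nat) \<Rightarrow> ('m + 'n \<Rightarrow> nat) operator \<Rightarrow> ('m \<Rightarrow> nat) operator" where
  "post_select k1 k2 \<rho> = (\<lambda>\<psi> a. \<rho> (append_fock \<psi> k2) (case_sum a k1))"

definition finite_fock_support :: "'a operator \<Rightarrow> bool" where
  "finite_fock_support T \<longleftrightarrow> finite {(a, a'). braket (basis_ket a) (T (basis_ket a')) \<noteq> 0}"

definition gaussian_core_state :: "('m::finite + 'n::finite \<Rightarrow> nat) operator \<Rightarrow> bool" where
  "gaussian_core_state \<rho> \<longleftrightarrow> gaussian_state \<rho> \<and>
     (\<forall>k1 k2. finite_fock_support (post_select k1 k2 \<rho>))"

text \<open>Polynomials in the variables \<open>'p\<close> are given by their finitely many coefficients, keyed by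
  multi-indices.\<close>

type_synonym 'p polynomial = "('p \<Rightarrow> nat) \<Rightarrow>\<^sub>0 complex"

definition poly_eval :: "'p::finite polynomial \<Rightarrow> complex ^ 'p \<Rightarrow> complex" where
  "poly_eval P z = (\<Sum>k\<in>Poly_Mapping.keys P. Poly_Mapping.lookup P k * (\<Prod>i\<in>UNIV. (z $ i) ^ k i))"

definition total_degree :: "'p::finite polynomial \<Rightarrow> nat" where
  "total_degree P = Max (insert 0 ((\<lambda>k. \<Sum>i\<in>UNIV. k i) ` Poly_Mapping.keys P))"

text \<open>The factorization into polynomial and Gaussian is unique up to a scalar, so for a unit vector
  the set below has at most one element: \<open>Inf\<close> is that element, or \<open>\<infinity>\<close> if there is none.\<close>

definition pure_stellar_rank :: "(('p::finite \<Rightarrow> nat) \<Rightarrow> complex) \<Rightarrow> enat" where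
  "pure_stellar_rank \<phi> = Inf {enat (total_degree P) | P.
     \<exists>Q. total_degree Q \<le> 2 \<and> (\<forall>z. bargmann_ket \<phi> z = poly_eval P z * exp (poly_eval Q z))}"

text \<open>Decompositions \<open>\<sigma> = (\<Sum>i. p i |\<phi> i\<rangle>\<langle>\<phi> i|)\<close> into countably many pure states, finite ones having
  \<open>p i = 0\<close> for almost all \<open>i\<close>.  Such a series always converges absolutely in trace norm, so
  comparing coordinates is enough.\<close>

definition pure_decomposition ::
    "'a operator \<Rightarrow> (nat \<Rightarrow> real) \<Rightarrow> (nat \<Rightarrow> 'a \<Rightarrow> complex) \<Rightarrow> bool" where
  "pure_decomposition \<sigma> p \<phi> \<longleftrightarrow>
     (\<forall>i. 0 \<le> p i) \<and> (p has_sum 1) UNIV \<and>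
     (\<forall>i. \<phi> i \<in> ell2 \<and> ell2_norm (\<phi> i) = 1) \<and>
     (\<forall>\<psi>\<in>ell2. \<forall>x. ((\<lambda>i. of_real (p i) * braket (\<phi> i) \<psi> * \<phi> i x) has_sum \<sigma> \<psi> x) UNIV)"

definition stellar_rank :: "('p::finite \<Rightarrow> nat) operator \<Rightarrow> enat" where
  "stellar_rank \<sigma> =
     Inf {Sup {pure_stellar_rank (\<phi> i) | i. 0 < p i} | p \<phi>. pure_decomposition \<sigma> p \<phi>}"

end

theory Submission
  imports Defs "HOL-Complex_Analysis.Cauchy_Integral_Formula"
    "HOL-Computational_Algebra.Fundamental_Theorem_Algebra"
begin

text \<open>The Bargmann function is an everywhere absolutely convergent power series in \<open>\<zeta>\<close> whose
  coefficients are, up to nonzero factors, the Fock matrix elements of \<open>\<rho>\<close>.  If the \<open>M\<close> blocks of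
  \<open>A\<close> and \<open>b\<close> vanish, every monomial of the exponent has at least as high a degree in \<open>\<zeta>\<^sub>N\<close> as in
  \<open>\<zeta>\<^sub>M\<close>, hence so has every monomial of the exponential; the matrix element between \<open>(a, k1)\<close> and
  \<open>(a', k2)\<close> is then zero unless \<open>|a| + |a'| \<le> |k1| + |k2|\<close>.  Conversely, post-selecting \<open>N\<close> on the
  vacuum sets \<open>\<zeta>\<^sub>N = 0\<close>, and finite support makes the remaining Gaussian in \<open>\<zeta>\<^sub>M\<close> a polynomial; on
  each complex line it is zero-free, hence constant.  For the stellar rank, the post-selected
  operator has no diagonal elements beyond \<open>|a| = |k|\<close>, so by positivity it lives on the finitely many
  Fock states with \<open>|a| \<le> |k|\<close>, and a Cholesky decomposition there yields pure states whose stellar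
  functions are polynomials of degree at most \<open>|k|\<close>.\<close>

section \<open>Power series in several variables\<close>

text \<open>Multi-mode convergence reduces to one mode at a time. The product rule
  \<open>abs_summable_on_prod_PiE\<close> speaks of the \<open>Infinite_Set_Sum\<close> notion,
  hence the translation in both directions.\<close>

lemma summable_on_prod_UNIV:
  fixes f :: "'p::finite \<Rightarrow> nat \<Rightarrow> real"
  assumes "\<And>i. summable (f i)" and "\<And>i n. 0 \<le> f i n"
  shows "(\<lambda>k. \<Prod>i\<in>UNIV. f i (k i)) summable_on UNIV"
proof -
  have "Infinite_Set_Sum.abs_summable_on (f i) UNIV" for i
    using assms by (simp add: abs_summable_on_nat_iff')
  then have "Infinite_Set_Sum.abs_summable_on (\<lambda>k. \<Prod>i\<in>UNIV. f i (k i)) (PiE UNIV (\<lambda>_. UNIV))"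
    by (intro abs_summable_on_prod_PiE) auto
  then show ?thesis
    by (metis PiE_UNIV_domain UNIV_I abs_summable_equivalent abs_summable_summable Pi_UNIV)
qed

text \<open>Convergence everywhere means infinite radius, so equality of the functions becomes
  equality of formal power series.\<close>

lemma power_series_coeff_unique:
  fixes a b :: "nat \<Rightarrow> complex"
  assumes "\<And>x. (\<lambda>n. a n * x ^ n) sums f x" and "\<And>x. (\<lambda>n. b n * x ^ n) sums f x"
  shows "a n = b n"
proof -
  have "conv_radius c = \<infinity>" if "\<And>x. summable (\<lambda>n. c n * x ^ n)" for c :: "nat \<Rightarrow> complex"
    using that by (rule conv_radius_inftyI'')
  then have "fps_conv_radius (Abs_fps a) = \<infinity>" "fps_conv_radius (Abs_fps b) = \<infinity>"
    using assms by (auto simp: fps_conv_radius_def summable_def)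
  moreover have "eval_fps (Abs_fps a) x = eval_fps (Abs_fps b) x" for x
    using assms[of x] by (simp add: eval_fps_def sums_iff)
  ultimately have "Abs_fps a = Abs_fps b"
    by (intro eval_fps_eqD) auto
  then show ?thesis by (metis fps_nth_Abs_fps)
qed

text \<open>Collecting the terms of equal degree \<open>h\<close> gives an ordinary power series in
  \<open>t\<close>, so that one-variable uniqueness can isolate a level set of \<open>h\<close>. The
  case \<open>t = 1\<close> supplies summability, and \<open>D\<close> is the disjoint union of the
  level sets.\<close>

lemma has_sum_graded:
  fixes f :: "'k \<Rightarrow> complex" and h :: "'k \<Rightarrow> nat"
  assumes "\<And>t::complex. ((\<lambda>k. f k * t ^ h k) has_sum G t) D"
  shows "f summable_on {k\<in>D. h k = n}"
    and "(\<lambda>n. infsum f {k\<in>D. h k = n} * t ^ n) sums G t"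
proof -
  have "f summable_on D"
    using assms[of 1] by (simp add: summable_on_def) blast
  then show summ: "f summable_on {k\<in>D. h k = n}" for n
    by (rule summable_on_subset_banach) auto
  have bij: "bij_betw snd (SIGMA n:UNIV. {k\<in>D. h k = n}) D"
    by (intro bij_betwI[where g="\<lambda>k. (h k, k)"]) auto
  have "((\<lambda>p. f (snd p) * t ^ h (snd p)) has_sum G t) (SIGMA n:UNIV. {k\<in>D. h k = n})"
    using has_sum_reindex_bij_betw[OF bij, of "\<lambda>k. f k * t ^ h k"] assms by simp
  moreover have "((\<lambda>k. f (snd (n, k)) * t ^ h (snd (n, k))) has_sum infsum f {k\<in>D. h k = n} * t ^ n)
      {k\<in>D. h k = n}" for n
    by (rule has_sum_cong[THEN iffD1, OF _ has_sum_cmult_left[OF has_sum_infsum[OF summ]]]) auto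
  ultimately have "((\<lambda>n. infsum f {k\<in>D. h k = n} * t ^ n) has_sum G t) UNIV"
    by (rule has_sum_SigmaD)
  then show "(\<lambda>n. infsum f {k\<in>D. h k = n} * t ^ n) sums G t"
    by (rule has_sum_imp_sums)
qed

definition mpow :: "complex ^ 'p::finite \<Rightarrow> ('p \<Rightarrow> nat) \<Rightarrow> complex" where
  "mpow z k = (\<Prod>i\<in>UNIV. (z $ i) ^ k i)"

text \<open>Variables are treated one at a time: the induction on \<open>S\<close> fixes the
  exponents in \<open>S\<close> to those of \<open>K\<close>, until only the term at
  \<open>K\<close> is left.\<close>

lemma multivariate_power_series_zero:
  fixes c :: "('p::finite \<Rightarrow> nat) \<Rightarrow> complex"
  assumes "\<And>z. ((\<lambda>k. c k * mpow z k) has_sum 0) UNIV"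
  shows "c K = 0"
proof -
  have partial: "((\<lambda>k. c k * (\<Prod>i\<in>-S. (z $ i) ^ k i)) has_sum 0) {k. \<forall>i\<in>S. k i = K i}"
    for S :: "'p set" and z
    using finite[of S]
  proof (induction S arbitrary: z)
    case empty
    then show ?case using assms[of z] by (simp add: mpow_def)
  next
    case (insert i S)
    define D where "D = {k. \<forall>j\<in>S. k j = K j}"
    define f where "f k = c k * (\<Prod>j\<in>-insert i S. (z $ j) ^ k j)" for k
    have compl: "- S = insert i (- insert i S)" using insert by auto
    have "((\<lambda>k. f k * t ^ k i) has_sum 0) D" for t
    proof -
      \<comment> \<open>The coordinate \<open>i\<close> becomes the free variable \<open>t\<close>,
        so its exponent serves as the degree in \<open>has_sum_graded\<close>.\<close>
      have "(\<Prod>j\<in>-S. ((\<chi> j. if j = i then t else z $ j) $ j) ^ k j)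
          = t ^ k i * (\<Prod>j\<in>-insert i S. (z $ j) ^ k j)" for k
        by (subst compl) (auto intro!: prod.cong)
      then show ?thesis
        using insert.IH[of "\<chi> j. if j = i then t else z $ j"]
        by (simp add: D_def f_def mult_ac)
    qed
    note graded = has_sum_graded[OF this]
    have "infsum f {k\<in>D. k i = K i} = 0"
      using power_series_coeff_unique[OF graded(2), of "\<lambda>_. 0"] by simp
    then have "(f has_sum 0) {k\<in>D. k i = K i}"
      using has_sum_infsum[OF graded(1)[of "K i"]] by simp
    moreover have "{k\<in>D. k i = K i} = {k. \<forall>j\<in>insert i S. k j = K j}"
      by (auto simp: D_def)
    ultimately show ?case by (simp add: f_def[abs_def])
  qed
  have "{k. \<forall>i\<in>UNIV. k i = K i} = {K}" by auto
  with partial[of _ UNIV] have "((\<lambda>k. c k) has_sum 0) {K}" by simp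
  then show ?thesis by (auto simp: has_sum_finite_iff)
qed

lemma entire_power_series:
  fixes f :: "complex \<Rightarrow> complex"
  assumes "f holomorphic_on UNIV"
  obtains e where "\<And>t. (\<lambda>n. e n * t ^ n) sums f t"
proof -
  have "(\<lambda>n. (deriv ^^ n) f 0 / fact n * t ^ n) sums f t" for t
    using holomorphic_power_series[of f 0 "norm t + 1" t] assms
    by (auto intro: holomorphic_on_subset)
  then show ?thesis by (rule that)
qed

text \<open>The zeros below \<open>p\<close> are what later kills the coefficients whose degree in
  the variables of N is too small.\<close>

lemma power_series_shift:
  fixes e :: "nat \<Rightarrow> complex"
  assumes "(\<lambda>n. e n * t ^ n) sums s"
  shows "(\<lambda>n. (if n < p then 0 else e (n - p)) * t ^ n) sums (t ^ p * s)"
proof -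
  have "(\<lambda>n. t ^ p * (e n * t ^ n)) sums (t ^ p * s)"
    using assms by (rule sums_mult)
  then have "(\<lambda>n. (if n + p < p then 0 else e (n + p - p)) * t ^ (n + p)) sums (t ^ p * s)"
    by (simp add: power_add mult_ac)
  then show ?thesis
    by (subst (asm) sums_iff_shift) (simp add: sum.neutral)
qed

section \<open>Coefficients of Gaussian functions\<close>

definition gauss_exponent :: "complex ^ 'p ^ 'p \<Rightarrow> complex ^ 'p \<Rightarrow> complex ^ 'p::finite \<Rightarrow> complex" where
  "gauss_exponent A b \<zeta> = cdot \<zeta> (A *v \<zeta>) / 2 + cdot \<zeta> b"

definition deg_Inl :: "('a::finite + 'b::finite \<Rightarrow> nat) \<Rightarrow> nat" where
  "deg_Inl \<kappa> = (\<Sum>i\<in>UNIV. \<kappa> (Inl i))"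

definition deg_Inr :: "('a::finite + 'b::finite \<Rightarrow> nat) \<Rightarrow> nat" where
  "deg_Inr \<kappa> = (\<Sum>i\<in>UNIV. \<kappa> (Inr i))"

text \<open>Independent scalings of the two blocks: the powers of \<open>s\<close> and
  \<open>t\<close> record the bidegree of a monomial.\<close>

definition scale_blocks :: "complex \<Rightarrow> complex \<Rightarrow> complex ^ ('a + 'b) \<Rightarrow> complex ^ ('a::finite + 'b::finite)" where
  "scale_blocks s t \<zeta> = (\<chi> x. (case x of Inl _ \<Rightarrow> s | Inr _ \<Rightarrow> t) * \<zeta> $ x)"

lemma sum_UNIV_sum:
  fixes f :: "'a::finite + 'b::finite \<Rightarrow> 'c::comm_monoid_add"
  shows "(\<Sum>x\<in>UNIV. f x) = (\<Sum>i\<in>UNIV. f (Inl i)) + (\<Sum>j\<in>UNIV. f (Inr j))"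
  using sum.Plus[of UNIV UNIV f] by simp

lemma prod_UNIV_sum:
  fixes f :: "'a::finite + 'b::finite \<Rightarrow> 'c::comm_monoid_mult"
  shows "(\<Prod>x\<in>UNIV. f x) = (\<Prod>i\<in>UNIV. f (Inl i)) * (\<Prod>j\<in>UNIV. f (Inr j))"
  using prod.Plus[of UNIV UNIV f] by simp

lemma mpow_scale_blocks:
  "mpow (scale_blocks s t \<zeta>) \<kappa> = mpow \<zeta> \<kappa> * s ^ deg_Inl \<kappa> * t ^ deg_Inr \<kappa>"
  by (simp add: mpow_def scale_blocks_def prod_UNIV_sum power_mult_distrib prod.distrib
      deg_Inl_def deg_Inr_def power_sum)

lemma gauss_exponent_expand:
  "gauss_exponent A b \<zeta> = (\<Sum>i\<in>UNIV. \<Sum>j\<in>UNIV. \<zeta> $ i * A $ i $ j * \<zeta> $ j) / 2 + (\<Sum>i\<in>UNIV. \<zeta> $ i * b $ i)"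
  by (simp add: gauss_exponent_def cdot_def matrix_vector_mult_def sum_distrib_left mult.assoc)

text \<open>The \<open>Inl\<close> variables occur only in the mixed blocks, so \<open>s\<close>
  enters linearly and always with a factor \<open>t\<close>. The coefficients depend on \<zeta>
  alone, which leaves \<open>s\<close> and \<open>t\<close> free to vary.\<close>

lemma gauss_exponent_scale_blocks:
  assumes "\<And>i j. A $ Inl i $ Inl j = 0" and "\<And>i. b $ Inl i = 0"
  obtains B C d where
    "\<And>s t. gauss_exponent A b (scale_blocks s t \<zeta>) = s * (t * B) + (t\<^sup>2 * C + t * d)"
proof -
  define x where "x i j = \<zeta> $ i * A $ i $ j * \<zeta> $ j" for i j
  have lin: "(\<Sum>i\<in>UNIV. (scale_blocks s t \<zeta>) $ i * b $ i) = t * (\<Sum>j\<in>UNIV. \<zeta> $ Inr j * b $ Inr j)" for s t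
    by (simp add: sum_UNIV_sum scale_blocks_def assms sum_distrib_left mult_ac)
  have quad: "(\<Sum>i\<in>UNIV. \<Sum>j\<in>UNIV. (scale_blocks s t \<zeta>) $ i * A $ i $ j * (scale_blocks s t \<zeta>) $ j)
     = s * t * ((\<Sum>i\<in>UNIV. \<Sum>j\<in>UNIV. x (Inl i) (Inr j)) + (\<Sum>i\<in>UNIV. \<Sum>j\<in>UNIV. x (Inr i) (Inl j)))
     + t\<^sup>2 * (\<Sum>i\<in>UNIV. \<Sum>j\<in>UNIV. x (Inr i) (Inr j))" for s t
    by (simp add: sum_UNIV_sum scale_blocks_def assms x_def sum_distrib_left sum.distrib
        distrib_left power2_eq_square mult_ac)
  show ?thesis
    by (rule that[of "((\<Sum>i\<in>UNIV. \<Sum>j\<in>UNIV. x (Inl i) (Inr j)) + (\<Sum>i\<in>UNIV. \<Sum>j\<in>UNIV. x (Inr i) (Inl j))) / 2"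
           "(\<Sum>i\<in>UNIV. \<Sum>j\<in>UNIV. x (Inr i) (Inr j)) / 2" "\<Sum>j\<in>UNIV. \<zeta> $ Inr j * b $ Inr j"])
      (unfold gauss_exponent_expand lin quad, simp add: field_simps)
qed

text \<open>In \<open>exp (s * (t * B))\<close> the coefficient of \<open>s ^ p\<close> carries the
  factor \<open>t ^ p\<close>, so its expansion in \<open>t\<close> has nothing at
  \<open>t ^ q\<close> for \<open>q < p\<close>. Taking coefficients first in \<open>s\<close> and
  then in \<open>t\<close> isolates the terms of bidegree \<open>(p, q)\<close>.\<close>

lemma gauss_coeff_zero:
  fixes A :: "complex ^ ('a::finite + 'b::finite) ^ ('a + 'b)"
  assumes A: "\<And>i j. A $ Inl i $ Inl j = 0" and b: "\<And>i. b $ Inl i = 0"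
    and series: "\<And>\<zeta>. ((\<lambda>\<kappa>. c \<kappa> * mpow \<zeta> \<kappa>) has_sum C * exp (gauss_exponent A b \<zeta>)) UNIV"
    and deg: "deg_Inr \<kappa> < deg_Inl \<kappa>"
  shows "c \<kappa> = 0"
proof -
  define p q where "p = deg_Inl \<kappa>" and "q = deg_Inr \<kappa>"
  \<comment> \<open>The nested comprehension has the shape that two uses of
    \<open>has_sum_graded\<close> produce.\<close>
  define K where "K = {\<kappa> \<in> {\<kappa>\<in>UNIV. deg_Inl \<kappa> = p}. deg_Inr (\<kappa> :: 'a + 'b \<Rightarrow> nat) = q}"
  have "((\<lambda>\<kappa>. c \<kappa> * mpow \<zeta> \<kappa>) has_sum 0) K" for \<zeta>
  proof -
    obtain B E d where expo:
      "\<And>s t. gauss_exponent A b (scale_blocks s t \<zeta>) = s * (t * B) + (t\<^sup>2 * E + t * d)"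
      using gauss_exponent_scale_blocks[OF A b] by metis
    \<comment> \<open>The part of the Gaussian free of \<open>s\<close>; being entire in
      \<open>t\<close>, it has a power series.\<close>
    define g where "g t = C * exp (t\<^sup>2 * E + t * d)" for t
    have "((\<lambda>\<kappa>. (c \<kappa> * mpow \<zeta> \<kappa> * t ^ deg_Inr \<kappa>) * s ^ deg_Inl \<kappa>) has_sum g t * exp (s * (t * B))) UNIV"
      for s t
      using series[of "scale_blocks s t \<zeta>"]
      by (simp add: mpow_scale_blocks expo exp_add g_def mult_ac)
    note s_graded = has_sum_graded[OF this]
    have "(\<lambda>n. g t * (t * B) ^ n / fact n * s ^ n) sums (g t * exp (s * (t * B)))" for s t
    proof -
      have "(\<lambda>n. (s * (t * B)) ^ n /\<^sub>R fact n) sums exp (s * (t * B))"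
        by (rule exp_converges)
      from sums_mult[OF this, of "g t"] show ?thesis
        by (simp add: scaleR_conv_of_real power_mult_distrib field_simps)
    qed
    from power_series_coeff_unique[OF s_graded(2) this]
    have inf: "infsum (\<lambda>\<kappa>. c \<kappa> * mpow \<zeta> \<kappa> * t ^ deg_Inr \<kappa>) {\<kappa>\<in>UNIV. deg_Inl \<kappa> = p}
        = g t * (t * B) ^ p / fact p" for t .
    have "((\<lambda>\<kappa>. c \<kappa> * mpow \<zeta> \<kappa> * t ^ deg_Inr \<kappa>) has_sum g t * (t * B) ^ p / fact p)
        {\<kappa>\<in>UNIV. deg_Inl \<kappa> = p}" for t
      using has_sum_infsum[OF s_graded(1)[of t p]] by (simp only: inf)
    note t_graded = has_sum_graded[OF this]
    have "(\<lambda>t. g t * B ^ p / fact p) holomorphic_on UNIV"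
      unfolding g_def by (intro holomorphic_intros) auto
    then obtain e where e: "\<And>t. (\<lambda>n. e n * t ^ n) sums (g t * B ^ p / fact p)"
      by (rule entire_power_series) blast
    have "(\<lambda>n. (if n < p then 0 else e (n - p)) * t ^ n) sums (g t * (t * B) ^ p / fact p)" for t
      using power_series_shift[OF e[of t], of p] by (simp add: power_mult_distrib mult_ac)
    from power_series_coeff_unique[OF t_graded(2) this]
    have "infsum (\<lambda>\<kappa>. c \<kappa> * mpow \<zeta> \<kappa>) K = 0"
      using deg by (simp add: K_def p_def q_def)
    with t_graded(1)[of q] show ?thesis
      unfolding K_def[symmetric] by (metis has_sum_infsum)
  qed
  \<comment> \<open>Filling in zeros outside bidegree \<open>(p, q)\<close> gives a series over all
    multi-indices, from which single coefficients can be read off.\<close>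
  then have "((\<lambda>\<kappa>. (if \<kappa> \<in> K then c \<kappa> else 0) * mpow \<zeta> \<kappa>) has_sum 0) UNIV" for \<zeta>
    by (rule has_sum_cong_neutral[THEN iffD1, rotated -1]) auto
  from multivariate_power_series_zero[OF this, of \<kappa>]
  show ?thesis by (simp add: K_def p_def q_def)
qed

text \<open>The exponential has no zeros, so a polynomial equal to such a Gaussian is constant by
  the fundamental theorem of algebra, and the derivative of the exponent vanishes
  identically.\<close>

lemma exp_quadratic_eq_poly:
  fixes \<alpha> \<beta> c :: complex
  assumes "\<And>t. poly P t = c * exp (\<alpha> * t\<^sup>2 + \<beta> * t)" and "c \<noteq> 0"
  shows "\<alpha> = 0" and "\<beta> = 0"
proof -
  have "constant (poly P)"
  proof (rule ccontr)
    assume "\<not> constant (poly P)"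
    from Fundamental_Theorem_Algebra.fundamental_theorem_of_algebra[OF this] obtain z where "poly P z = 0" ..
    with assms show False by simp
  qed
  then have "poly P t = poly P 0" for t
    unfolding constant_def by blast
  then have one: "exp (\<alpha> * t\<^sup>2 + \<beta> * t) = 1" for t
    using assms by simp
  have der: "((\<lambda>t. exp (\<alpha> * t\<^sup>2 + \<beta> * t)) has_field_derivative
      exp (\<alpha> * t\<^sup>2 + \<beta> * t) * (2 * \<alpha> * t + \<beta>)) (at t)" for t
    by (auto intro!: derivative_eq_intros)
  have "2 * \<alpha> * t + \<beta> = 0" for t
    using DERIV_unique[OF der[of t], of 0] by (simp add: one)
  from this[of 0] this[of 1] show "\<alpha> = 0" "\<beta> = 0" by auto
qed

text \<open>Along a line through 0 in the \<open>Inl\<close> variables only finitely many monomials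
  survive, so the Gaussian is a polynomial there and \<open>exp_quadratic_eq_poly\<close> applies.
  Polarization recovers the matrix entries from the quadratic form.\<close>

lemma gauss_block_zero:
  fixes A :: "complex ^ ('a::finite + 'b::finite) ^ ('a + 'b)"
  assumes sym: "transpose A = A"
    and series: "\<And>\<zeta>. ((\<lambda>\<kappa>. c \<kappa> * mpow \<zeta> \<kappa>) has_sum C * exp (gauss_exponent A b \<zeta>)) UNIV"
    and C: "C \<noteq> 0"
    and fin: "finite {\<kappa>. deg_Inr \<kappa> = 0 \<and> c \<kappa> \<noteq> 0}"
  shows "A $ Inl i $ Inl j = 0" and "b $ Inl i = 0"
proof -
  let ?K = "{\<kappa>. deg_Inr \<kappa> = 0 \<and> c \<kappa> \<noteq> 0}"
  define quad where "quad \<zeta> = cdot \<zeta> (A *v \<zeta>)" for \<zeta>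
  define emb :: "('a \<Rightarrow> complex) \<Rightarrow> complex ^ ('a + 'b)" where
    "emb v = (\<chi> x. case x of Inl i \<Rightarrow> v i | Inr _ \<Rightarrow> 0)" for v
  have *: "quad (emb v) = 0 \<and> cdot (emb v) b = 0" for v
  proof -
    define P where "P = (\<Sum>\<kappa>\<in>?K. monom (c \<kappa> * mpow (emb v) \<kappa>) (deg_Inl \<kappa>))"
    have "poly P t = C * exp (quad (emb v) / 2 * t\<^sup>2 + cdot (emb v) b * t)" for t
    proof -
      \<comment> \<open>Scaling the second block by 0 leaves the factor
        \<open>0 ^ deg_Inr \<kappa>\<close>, which is 1 if there are no \<open>Inr\<close> exponents
        (\<open>0 ^ 0 = 1\<close>) and 0 otherwise.\<close>
      have "emb (\<lambda>i. t * v i) = scale_blocks t 0 (emb v)"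
        by (auto simp: emb_def scale_blocks_def vec_eq_iff split: sum.split)
      then have mp: "mpow (emb (\<lambda>i. t * v i)) \<kappa> = mpow (emb v) \<kappa> * t ^ deg_Inl \<kappa> * 0 ^ deg_Inr \<kappa>" for \<kappa>
        by (simp only: mpow_scale_blocks)
      have "poly P t = (\<Sum>\<kappa>\<in>?K. c \<kappa> * mpow (emb (\<lambda>i. t * v i)) \<kappa>)"
        by (simp add: P_def poly_sum poly_monom mp mult_ac)
      moreover have "((\<lambda>\<kappa>. c \<kappa> * mpow (emb (\<lambda>i. t * v i)) \<kappa>) has_sum
          (\<Sum>\<kappa>\<in>?K. c \<kappa> * mpow (emb (\<lambda>i. t * v i)) \<kappa>)) UNIV"
        by (rule has_sum_finite_neutralI[OF fin]) (auto simp: mp)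
      ultimately have "poly P t = C * exp (gauss_exponent A b (emb (\<lambda>i. t * v i)))"
        using has_sum_unique[OF _ series] by metis
      moreover have "emb (\<lambda>i. t * v i) $ x = t * emb v $ x" for x
        by (simp add: emb_def split: sum.split)
      then have "gauss_exponent A b (emb (\<lambda>i. t * v i)) = quad (emb v) / 2 * t\<^sup>2 + cdot (emb v) b * t"
        by (simp add: gauss_exponent_def quad_def cdot_def matrix_vector_mult_def sum_distrib_left
            sum_distrib_right sum_divide_distrib power2_eq_square mult_ac)
      ultimately show ?thesis by simp
    qed
    from exp_quadratic_eq_poly[OF this C] show ?thesis by simp
  qed
  have emb_axis: "emb (\<lambda>k. if k = i then 1 else 0) = axis (Inl i) 1" for i
    by (auto simp: emb_def axis_def vec_eq_iff split: sum.split)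
  have cdot_axis: "cdot (axis x 1) v = v $ x" for x and v :: "complex ^ ('a + 'b)"
    by (simp add: cdot_def axis_def if_distrib[of "\<lambda>y. y * _"] cong: if_cong)
  have matrix_axis: "(A *v axis y 1) $ x = A $ x $ y" for x y
    by (simp add: matrix_vector_mult_def axis_def if_distrib cong: if_cong)
  show "b $ Inl i = 0"
    using *[of "\<lambda>k. if k = i then 1 else 0"] by (simp add: emb_axis cdot_axis)
  \<comment> \<open>Polarization; the symmetry of \<open>A\<close> merges the two cross
    terms.\<close>
  have quad_axis: "quad (axis x 1 + axis y 1) = A $ x $ x + A $ y $ y + 2 * A $ x $ y" for x y
  proof -
    have "A $ y $ x = transpose A $ x $ y" by (simp add: transpose_def)
    then have "A $ y $ x = A $ x $ y" by (simp add: sym)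
    moreover have "cdot (u + v) w = cdot u w + cdot v w" "cdot u (v + w) = cdot u v + cdot u w"
      for u v w :: "complex ^ ('a + 'b)"
      by (simp_all add: cdot_def algebra_simps sum.distrib)
    ultimately show ?thesis
      by (simp add: quad_def matrix_vector_right_distrib cdot_axis matrix_axis)
  qed
  have diag: "A $ Inl i $ Inl i = 0" for i
    using *[of "\<lambda>k. if k = i then 1 else 0"]
    by (simp add: emb_axis quad_def cdot_axis matrix_axis)
  have "emb (\<lambda>k. (if k = i then 1 else 0) + (if k = j then 1 else 0)) = axis (Inl i) 1 + axis (Inl j) 1"
    by (auto simp: emb_def axis_def vec_eq_iff split: sum.split)
  then have "quad (axis (Inl i) 1 + axis (Inl j) 1) = 0" using * by metis
  then show "A $ Inl i $ Inl j = 0" by (simp add: quad_axis diag)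
qed

section \<open>Fock expansion of the Bargmann function\<close>

lemma basis_ket_ell2: "basis_ket a \<in> ell2"
  unfolding ell2_def basis_ket_def mem_Collect_eq
  by (rule has_sum_imp_summable, rule has_sum_finite_neutralI[of "{a}"]) auto

lemma braket_basis_ket: "braket (basis_ket a) \<phi> = \<phi> a"
  unfolding braket_def basis_ket_def
  by (rule infsumI, rule has_sum_finite_neutralI[of "{a}"]) auto

lemma ell2_norm_basis_ket: "ell2_norm (basis_ket a) = 1"
proof -
  have "(\<Sum>\<^sub>\<infinity>x. (cmod (basis_ket a x))\<^sup>2) = 1"
    unfolding basis_ket_def by (rule infsumI, rule has_sum_finite_neutralI[of "{a}"]) auto
  then show ?thesis by (simp add: ell2_norm_def)
qed

lemma norm_le_ell2_norm:
  assumes "\<phi> \<in> ell2"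
  shows "norm (\<phi> x) \<le> ell2_norm \<phi>"
proof -
  have "(norm (\<phi> x))\<^sup>2 = (\<Sum>\<^sub>\<infinity>y\<in>{x}. (cmod (\<phi> y))\<^sup>2)" by simp
  also have "\<dots> \<le> (\<Sum>\<^sub>\<infinity>y. (cmod (\<phi> y))\<^sup>2)"
    using assms by (intro infsum_mono2) (auto simp: ell2_def)
  finally show ?thesis
    unfolding ell2_norm_def by (rule real_le_rsqrt)
qed

lemma finite_support_ell2:
  assumes "finite S" and "\<And>x. x \<notin> S \<Longrightarrow> \<psi> x = 0"
  shows "\<psi> \<in> ell2"
  unfolding ell2_def mem_Collect_eq
  by (rule has_sum_imp_summable, rule has_sum_finite_neutralI[of S]) (use assms in auto)

lemma bounded_operator_ell2: "bounded_operator T \<Longrightarrow> \<psi> \<in> ell2 \<Longrightarrow> T \<psi> \<in> ell2"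
  and bounded_operator_add: "bounded_operator T \<Longrightarrow> \<phi> \<in> ell2 \<Longrightarrow> \<psi> \<in> ell2 \<Longrightarrow>
    T (\<lambda>x. \<phi> x + \<psi> x) = (\<lambda>x. T \<phi> x + T \<psi> x)"
  and bounded_operator_scale: "bounded_operator T \<Longrightarrow> \<psi> \<in> ell2 \<Longrightarrow>
    T (\<lambda>x. c * \<psi> x) = (\<lambda>x. c * T \<psi> x)"
  by (auto simp: bounded_operator_def)

lemma bounded_operator_matrix_elements_bounded:
  assumes "bounded_operator T"
  obtains B where "\<And>a b. norm (T (basis_ket b) a) \<le> B"
proof -
  from assms obtain B where B: "\<And>\<psi>. \<psi> \<in> ell2 \<Longrightarrow> ell2_norm (T \<psi>) \<le> B * ell2_norm \<psi>"
    unfolding bounded_operator_def by blast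
  have "norm (T (basis_ket b) a) \<le> B" for a b
    using norm_le_ell2_norm[OF bounded_operator_ell2[OF assms basis_ket_ell2], of b a]
      B[OF basis_ket_ell2[of b]] by (simp add: ell2_norm_basis_ket)
  then show ?thesis by (rule that)
qed

lemma bounded_operator_finite_support:
  assumes T: "bounded_operator T" and "finite S"
  shows "T (\<lambda>x. if x \<in> S then \<psi> x else 0) a = (\<Sum>l\<in>S. T (basis_ket l) a * \<psi> l)"
  using assms(2)
proof induction
  case empty
  \<comment> \<open>Homogeneity with the scalar 0 shows that \<open>T\<close> maps the zero vector
    to itself.\<close>
  then show ?case
    using bounded_operator_scale[OF T basis_ket_ell2, of 0] by (simp add: fun_eq_iff)
next
  case (insert l S)
  have "(\<lambda>x. if x \<in> insert l S then \<psi> x else 0)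
      = (\<lambda>x. \<psi> l * basis_ket l x + (if x \<in> S then \<psi> x else 0))"
    using insert by (auto simp: fun_eq_iff basis_ket_def)
  moreover have "(\<lambda>x. \<psi> l * basis_ket l x) \<in> ell2"
    by (rule finite_support_ell2[of "{l}"]) (auto simp: basis_ket_def)
  moreover have "(\<lambda>x. if x \<in> S then \<psi> x else 0) \<in> ell2"
    using insert by (intro finite_support_ell2[of S]) auto
  ultimately show ?case
    using insert
    by (simp add: bounded_operator_add[OF T] bounded_operator_scale[OF T basis_ket_ell2] mult.commute)
qed

text \<open>Linearity settles the finite partial sums. Boundedness makes the image of the discarded
  tail tend to 0, as the squared norm of the tail is \<open>N\<close> minus the partial sum.\<close>

lemma bounded_operator_coordinate:
  assumes T: "bounded_operator T" and \<psi>: "\<psi> \<in> ell2"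
  shows "((\<lambda>l. T (basis_ket l) a * \<psi> l) has_sum T \<psi> a) UNIV"
proof -
  from T obtain B where B: "\<And>\<psi>. \<psi> \<in> ell2 \<Longrightarrow> ell2_norm (T \<psi>) \<le> B * ell2_norm \<psi>"
    unfolding bounded_operator_def by blast
  define N where "N = (\<Sum>\<^sub>\<infinity>x. (cmod (\<psi> x))\<^sup>2)"
  have summ: "(\<lambda>x. (cmod (\<psi> x))\<^sup>2) summable_on UNIV" using \<psi> by (simp add: ell2_def)
  have "((\<lambda>x. (cmod (\<psi> x))\<^sup>2) has_sum N) UNIV"
    unfolding N_def using summ by (rule has_sum_infsum)
  then have lim: "((\<lambda>F. \<Sum>x\<in>F. (cmod (\<psi> x))\<^sup>2) \<longlongrightarrow> N) (finite_subsets_at_top UNIV)"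
    by (simp add: has_sum_def)
  have "((\<lambda>F. B * sqrt (N - (\<Sum>x\<in>F. (cmod (\<psi> x))\<^sup>2))) \<longlongrightarrow> B * sqrt (N - N)) (finite_subsets_at_top UNIV)"
    by (intro tendsto_intros lim)
  then have null: "((\<lambda>F. B * sqrt (N - (\<Sum>x\<in>F. (cmod (\<psi> x))\<^sup>2))) \<longlongrightarrow> 0) (finite_subsets_at_top UNIV)"
    by simp
  have bound: "norm ((\<Sum>l\<in>F. T (basis_ket l) a * \<psi> l) - T \<psi> a)
      \<le> B * sqrt (N - (\<Sum>x\<in>F. (cmod (\<psi> x))\<^sup>2))" if F: "finite F" for F
  proof -
    define head where "head x = (if x \<in> F then \<psi> x else 0)" for x
    define tail where "tail x = (if x \<in> F then 0 else \<psi> x)" for x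
    have norm_tail: "(\<lambda>x. (cmod (tail x))\<^sup>2) summable_on UNIV \<and>
        (\<Sum>\<^sub>\<infinity>x. (cmod (tail x))\<^sup>2) = N - (\<Sum>x\<in>F. (cmod (\<psi> x))\<^sup>2)"
    proof -
      have "((\<lambda>x. (cmod (\<psi> x))\<^sup>2) has_sum (N - (\<Sum>x\<in>F. (cmod (\<psi> x))\<^sup>2))) (UNIV - F)"
        unfolding N_def using F summ by (intro has_sum_Diff has_sum_infsum has_sum_finite) auto
      then have "((\<lambda>x. (cmod (tail x))\<^sup>2) has_sum (N - (\<Sum>x\<in>F. (cmod (\<psi> x))\<^sup>2))) UNIV"
        by (rule has_sum_cong_neutral[THEN iffD1, rotated -1]) (auto simp: tail_def)
      then show ?thesis by (auto intro: infsumI has_sum_imp_summable)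
    qed
    then have tail: "tail \<in> ell2" by (simp add: ell2_def)
    have head: "head \<in> ell2"
      using F by (intro finite_support_ell2[of F]) (auto simp: head_def)
    have "\<psi> = (\<lambda>x. head x + tail x)" by (auto simp: head_def tail_def)
    then have "T \<psi> a = T head a + T tail a"
      using bounded_operator_add[OF T head tail] by metis
    also have "T head a = (\<Sum>l\<in>F. T (basis_ket l) a * \<psi> l)"
      unfolding head_def[abs_def] by (rule bounded_operator_finite_support[OF T F])
    finally have "norm ((\<Sum>l\<in>F. T (basis_ket l) a * \<psi> l) - T \<psi> a) = norm (T tail a)"
      by simp
    also have "\<dots> \<le> B * ell2_norm tail"
      using norm_le_ell2_norm[OF bounded_operator_ell2[OF T tail], of a] B[OF tail] by simp
    also have "ell2_norm tail = sqrt (N - (\<Sum>x\<in>F. (cmod (\<psi> x))\<^sup>2))"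
      using norm_tail by (simp add: ell2_norm_def)
    finally show ?thesis .
  qed
  have "((\<lambda>F. (\<Sum>l\<in>F. T (basis_ket l) a * \<psi> l) - T \<psi> a) \<longlongrightarrow> 0) (finite_subsets_at_top UNIV)"
    by (rule Lim_null_comparison[OF _ null]) (use bound in \<open>auto intro: eventually_finite_subsets_at_top_weakI\<close>)
  then show ?thesis
    unfolding has_sum_def using Lim_null by blast
qed

definition sqrt_fact :: "('p::finite \<Rightarrow> nat) \<Rightarrow> complex" where
  "sqrt_fact k = (\<Prod>i\<in>UNIV. of_real (sqrt (fact (k i))))"

lemma sqrt_fact_nonzero: "sqrt_fact k \<noteq> 0"
  by (simp add: sqrt_fact_def)

lemma coherent_eq_mpow:
  "coherent z k = of_real (exp (- (norm z)\<^sup>2 / 2)) * (mpow z k / sqrt_fact k)"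
  by (simp add: coherent_def mpow_def sqrt_fact_def prod_dividef)

text \<open>The conjugations in the bra and in \<open>vec_cnj\<close> cancel, which makes the
  Bargmann function a power series in \<open>z\<close> rather than in its conjugate.\<close>

lemma cnj_coherent_vec_cnj: "cnj (coherent (vec_cnj z) k) = coherent z k"
proof -
  have "norm (vec_cnj z) = norm z"
    by (simp add: vec_cnj_def norm_vec_def)
  then show ?thesis by (simp add: coherent_def vec_cnj_def cnj_prod)
qed

text \<open>Even the square root of the factorial outgrows every power. With the uniform bound on
  the matrix elements of a bounded operator, this gives absolute convergence of the Bargmann double
  series.\<close>

lemma mpow_div_sqrt_fact_summable:
  "(\<lambda>k. norm (mpow z k / sqrt_fact k)) summable_on UNIV"
proof -
  have "summable (\<lambda>n. x ^ n / sqrt (fact n))" if "0 \<le> x" for x :: real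
  proof (rule summable_ratio_test)
    \<comment> \<open>From \<open>4 * x\<^sup>2\<close> on, the ratio
      \<open>x / sqrt (n + 1)\<close> of successive terms is at most 1/2.\<close>
    fix n assume n: "nat \<lceil>4 * x\<^sup>2\<rceil> \<le> n"
    then have "sqrt (4 * x\<^sup>2) \<le> sqrt (real (Suc n))"
      by (intro real_sqrt_le_mono) linarith
    then have "2 * x \<le> sqrt (real (Suc n))"
      using that by (simp add: real_sqrt_mult)
    then have "x / sqrt (real (Suc n)) \<le> 1 / 2"
      by (simp add: divide_simps)
    then have "x / sqrt (real (Suc n)) * (x ^ n / sqrt (fact n)) \<le> 1 / 2 * (x ^ n / sqrt (fact n))"
      using that by (intro mult_right_mono) auto
    then show "norm (x ^ Suc n / sqrt (fact (Suc n))) \<le> 1 / 2 * norm (x ^ n / sqrt (fact n))"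
      using that by (simp add: real_sqrt_mult)
  qed auto
  then have "(\<lambda>k. \<Prod>i\<in>UNIV. norm (z $ i) ^ k i / sqrt (fact (k i))) summable_on UNIV"
    by (intro summable_on_prod_UNIV) auto
  then show ?thesis
    by (simp add: mpow_def sqrt_fact_def norm_divide norm_power prod_dividef flip: prod_norm)
qed

lemma coherent_ell2: "coherent z \<in> ell2"
proof -
  have "summable (\<lambda>n. (norm (z $ i) ^ 2) ^ n / fact n)" for i
    using summable_exp[of "norm (z $ i) ^ 2"] by (simp add: field_simps)
  then have "(\<lambda>k. \<Prod>i\<in>UNIV. (norm (z $ i) ^ 2) ^ k i / fact (k i)) summable_on UNIV"
    by (intro summable_on_prod_UNIV) auto
  then have "(\<lambda>k. (exp (- (norm z)\<^sup>2 / 2))\<^sup>2 * (\<Prod>i\<in>UNIV. (norm (z $ i) ^ 2) ^ k i / fact (k i))) summable_on UNIV"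
    by (rule summable_on_cmult_right)
  moreover have "(cmod (coherent z k))\<^sup>2
      = (exp (- (norm z)\<^sup>2 / 2))\<^sup>2 * (\<Prod>i\<in>UNIV. (norm (z $ i) ^ 2) ^ k i / fact (k i))" for k
  proof -
    have "cmod (coherent z k) = exp (- (norm z)\<^sup>2 / 2) * (\<Prod>i\<in>UNIV. norm (z $ i) ^ k i / sqrt (fact (k i)))"
      by (simp add: coherent_def norm_mult norm_divide norm_power flip: prod_norm)
    moreover have "(norm (z $ i) ^ k i / sqrt (fact (k i)))\<^sup>2 = (norm (z $ i) ^ 2) ^ k i / fact (k i)" for i
      by (simp add: power_divide mult.commute flip: power_mult)
    ultimately show ?thesis
      by (simp only: power_mult_distrib prod_power_distrib)
  qed
  ultimately show ?thesis
    by (simp only: ell2_def mem_Collect_eq)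
qed

text \<open>Absolute convergence permits summing over the ket index first, which gives the
  coordinates of \<open>T (coherent w)\<close>, and then over the bra index, which gives the inner
  product. The Gaussian prefactors of the coherent states cancel the weight in
  \<open>bargmann_op\<close>.\<close>

lemma bargmann_op_has_sum:
  assumes T: "bounded_operator T"
  shows "((\<lambda>(k, l). T (basis_ket l) k * (mpow z k / sqrt_fact k) * (mpow w l / sqrt_fact l))
    has_sum bargmann_op T z w) UNIV"
proof -
  define u where "u z k = mpow z k / sqrt_fact k" for z :: "complex ^ 'a" and k
  let ?f = "\<lambda>(k, l). T (basis_ket l) k * u z k * u w l"
  obtain B where B: "\<And>a b. norm (T (basis_ket b) a) \<le> B"
    using bounded_operator_matrix_elements_bounded[OF T] by blast
  have nu: "(\<lambda>k. norm (u z k)) summable_on UNIV" for z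
    unfolding u_def by (rule mpow_div_sqrt_fact_summable)
  have "(\<lambda>(k, l). norm (u z k) * norm (u w l)) summable_on (UNIV \<times> UNIV)"
    by (rule summable_on_SigmaI[where g="\<lambda>k. norm (u z k) * (\<Sum>\<^sub>\<infinity>l. norm (u w l))"])
      (auto intro!: has_sum_cmult_right summable_on_cmult_left has_sum_infsum nu)
  then have "(\<lambda>p. B * (norm (u z (fst p)) * norm (u w (snd p)))) summable_on UNIV"
    by (intro summable_on_cmult_right) (simp add: case_prod_unfold)
  then have "(\<lambda>p. norm (?f p)) summable_on UNIV"
    by (rule Infinite_Sum.abs_summable_on_comparison_test')
      (auto simp: norm_mult mult.assoc intro!: mult_right_mono B)
  then have summ: "?f summable_on UNIV" by (rule abs_summable_summable)
  define S where "S = infsum ?f UNIV"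
  have S: "(?f has_sum S) (UNIV \<times> UNIV)"
    using summ by (simp add: S_def)
  define ez ew where "ez = complex_of_real (exp (- (norm z)\<^sup>2 / 2))"
    and "ew = complex_of_real (exp (- (norm w)\<^sup>2 / 2))"
  have ne: "ez \<noteq> 0" "ew \<noteq> 0" by (simp_all add: ez_def ew_def)
  have coh: "coherent z k = ez * u z k" "coherent w k = ew * u w k" for k
    by (simp_all add: coherent_eq_mpow u_def ez_def ew_def)
  have "((\<lambda>l. ?f (k, l)) has_sum u z k * (T (coherent w) k / ew)) UNIV" for k
    using has_sum_cmult_right[OF bounded_operator_coordinate[OF T coherent_ell2[of w], of k], of "u z k / ew"] ne
    by (simp add: coh mult_ac)
  from has_sum_SigmaD[OF S this]
  have "((\<lambda>k. u z k * (T (coherent w) k / ew)) has_sum S) UNIV" .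
  from has_sum_cmult_right[OF this, of "ez * ew"]
  have "((\<lambda>k. cnj (coherent (vec_cnj z) k) * T (coherent w) k) has_sum (ez * ew * S)) UNIV"
    using ne by (simp add: cnj_coherent_vec_cnj coh mult_ac)
  then have "braket (coherent (vec_cnj z)) (T (coherent w)) = ez * ew * S"
    unfolding braket_def by (rule infsumI)
  moreover have "complex_of_real (exp (((norm z)\<^sup>2 + (norm w)\<^sup>2) / 2)) * (ez * ew) = 1"
    by (simp add: ez_def ew_def field_simps flip: of_real_mult exp_add)
  ultimately have "bargmann_op T z w = S"
    by (simp add: bargmann_op_def mult.assoc[symmetric])
  with S show ?thesis by (simp add: u_def)
qed

section \<open>Positive semidefinite kernels\<close>

text \<open>Membership in the nonnegative reals also demands that the form be real; hermiticity
  follows from this below.\<close>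

definition psd_on :: "'a set \<Rightarrow> ('a \<Rightarrow> 'a \<Rightarrow> complex) \<Rightarrow> bool" where
  "psd_on U M \<longleftrightarrow> (\<forall>v. (\<Sum>a\<in>U. \<Sum>b\<in>U. cnj (v a) * M a b * v b) \<in> \<real>\<^sub>\<ge>\<^sub>0)"

lemma psd_on_subset:
  assumes "psd_on U M" and "finite U" and "V \<subseteq> U"
  shows "psd_on V M"
  unfolding psd_on_def
proof
  fix v :: "'a \<Rightarrow> complex"
  define w where "w a = (if a \<in> V then v a else 0)" for a
  have "(\<Sum>a\<in>U. \<Sum>b\<in>U. cnj (w a) * M a b * w b) = (\<Sum>a\<in>V. \<Sum>b\<in>U. cnj (w a) * M a b * w b)"
    using assms by (intro sum.mono_neutral_right) (auto simp: w_def)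
  also have "\<dots> = (\<Sum>a\<in>V. \<Sum>b\<in>V. cnj (w a) * M a b * w b)"
    using assms by (intro sum.cong refl sum.mono_neutral_right) (auto simp: w_def)
  also have "\<dots> = (\<Sum>a\<in>V. \<Sum>b\<in>V. cnj (v a) * M a b * v b)"
    by (simp add: w_def)
  finally show "(\<Sum>a\<in>V. \<Sum>b\<in>V. cnj (v a) * M a b * v b) \<in> \<real>\<^sub>\<ge>\<^sub>0"
    using assms(1)[unfolded psd_on_def, rule_format, of w] by (simp only:)
qed

lemma psd_on_diagonal:
  assumes "psd_on U M" and "finite U" and "a \<in> U"
  shows "M a a \<in> \<real>\<^sub>\<ge>\<^sub>0"
proof -
  have "psd_on {a} M" using assms by (auto intro: psd_on_subset[OF assms(1,2)])
  from this[unfolded psd_on_def, rule_format, of "\<lambda>_. 1"] show ?thesis by simp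
qed

lemma psd_on_pair:
  assumes "psd_on U M" and "finite U" and "a \<in> U" and "b \<in> U" and "a \<noteq> b"
  shows "cnj x * M a a * x + cnj x * M a b * y + cnj y * M b a * x + cnj y * M b b * y \<in> \<real>\<^sub>\<ge>\<^sub>0"
proof -
  have "psd_on {a, b} M" using assms by (auto intro: psd_on_subset[OF assms(1,2)])
  from this[unfolded psd_on_def, rule_format, of "\<lambda>c. if c = a then x else y"] \<open>a \<noteq> b\<close>
  show ?thesis by (simp add: add.assoc)
qed

lemma psd_on_hermitian:
  assumes "psd_on U M" and "finite U" and "a \<in> U" and "b \<in> U"
  shows "M b a = cnj (M a b)"
proof (cases "a = b")
  case True
  then show ?thesis
    using psd_on_diagonal[OF assms(1-3)] by (simp add: complex_nonneg_Reals_iff complex_eq_iff)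
next
  case False
  note diag = psd_on_diagonal[OF assms(1,2,3)] psd_on_diagonal[OF assms(1,2,4)]
  note pair = psd_on_pair[OF assms False]
  have im: "Im (M a a) = 0" "Im (M b b) = 0"
    using diag by (auto simp: complex_nonneg_Reals_iff)
  \<comment> \<open>Reality at the test vector \<open>(1, 1)\<close> settles the imaginary parts,
    reality at \<open>(1, \<i>)\<close> the real parts.\<close>
  have "Im (M a a) + Im (M a b) + Im (M b a) + Im (M b b) = 0"
    using pair[of 1 1] unfolding complex_nonneg_Reals_iff by simp
  moreover have "Im (M a a) + Re (M a b) - Re (M b a) + Im (M b b) = 0"
    using pair[of 1 \<i>] unfolding complex_nonneg_Reals_iff by simp
  ultimately have "Re (M b a) = Re (M a b)" "Im (M b a) = - Im (M a b)"
    using im by linarith+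
  then show ?thesis by (metis complex.collapse complex_cnj)
qed

text \<open>With \<open>M a a = 0\<close> the form has no quadratic term in the component at
  \<open>a\<close>, so a nonzero linear term could make it negative.\<close>

lemma psd_on_diagonal_zero:
  assumes "psd_on U M" and "finite U" and "a \<in> U" and "b \<in> U" and "M a a = 0"
  shows "M a b = 0" and "M b a = 0"
proof -
  show "M a b = 0"
  proof (rule ccontr)
    assume neq: "M a b \<noteq> 0"
    with assms(5) have "a \<noteq> b" by auto
    define q where "q = (cmod (M a b))\<^sup>2"
    have q: "q > 0" using neq by (simp add: q_def)
    \<comment> \<open>With this \<open>t\<close> the form at \<open>(x, 1)\<close> has real part
      -1.\<close>
    define t where "t = (Re (M b b) + 1) / (2 * q)"
    define x where "x = - of_real t * M a b"
    have q_eq: "of_real q = M a b * cnj (M a b)"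
      unfolding q_def by (rule complex_norm_square)
    have "cnj x * M a b = of_real (- t * q)"
      by (simp add: x_def q_eq)
    moreover have "M b a * x = of_real (- t * q)"
      using psd_on_hermitian[OF assms(1-4)]
      by (simp add: x_def q_eq)
    ultimately have "of_real (- t * q) + of_real (- t * q) + M b b \<in> \<real>\<^sub>\<ge>\<^sub>0"
      using psd_on_pair[OF assms(1-4) \<open>a \<noteq> b\<close>, of x 1] assms(5) by simp
    then have "2 * (q * t) \<le> Re (M b b)"
      by (simp add: complex_nonneg_Reals_iff mult_ac)
    moreover have "2 * (q * t) = Re (M b b) + 1"
      using q by (simp add: t_def)
    ultimately show False by simp
  qed
  then show "M b a = 0" using psd_on_hermitian[OF assms(1-4)] by simp
qed

text \<open>The elimination step of a Cholesky decomposition: removing this rank-one kernel clears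
  the row and the column of the pivot \<open>a0\<close>.\<close>

lemma psd_on_schur_complement:
  assumes psd: "psd_on U M" and "finite U" and "a0 \<in> U" and "M a0 a0 = d" and d: "d \<noteq> 0"
  shows "psd_on U (\<lambda>a b. M a b - M a a0 * M a0 b / d)"
  unfolding psd_on_def
proof
  fix v :: "'a \<Rightarrow> complex"
  have real_d: "cnj d = d"
    using psd_on_diagonal[OF assms(1-3)] assms(4) by (simp add: complex_nonneg_Reals_iff complex_eq_iff)
  define L where "L = (\<Sum>b\<in>U. M a0 b * v b)"
  have L': "cnj L = (\<Sum>a\<in>U. cnj (v a) * M a a0)"
    using psd_on_hermitian[OF assms(1,2) \<open>a0 \<in> U\<close>] by (simp add: L_def mult.commute)
  define e where "e a = (if a = a0 then 1 else 0 :: complex)" for a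
  \<comment> \<open>Completing the square: the form of the complement at \<open>v\<close> is that of \<open>M\<close> at \<open>w\<close>.\<close>
  define t where "t = - L / d"
  define w where "w a = v a + t * e a" for a
  have e_sum: "(\<Sum>b\<in>U. f b * e b) = f a0" for f :: "'a \<Rightarrow> complex"
    using assms by (simp add: e_def if_distrib[of "\<lambda>x. _ * x"] cong: if_cong)
  have "(\<Sum>b\<in>U. M a b * w b) = (\<Sum>b\<in>U. M a b * v b) + t * M a a0" for a
    using e_sum[of "\<lambda>b. t * M a b"] by (simp add: w_def algebra_simps sum.distrib)
  moreover define g where "g a = (\<Sum>b\<in>U. M a b * v b) + t * M a a0" for a
  ultimately have "(\<Sum>a\<in>U. \<Sum>b\<in>U. cnj (w a) * M a b * w b) = (\<Sum>a\<in>U. cnj (w a) * g a)"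
    by (simp add: mult.assoc flip: sum_distrib_left)
  also have "\<dots> = (\<Sum>a\<in>U. cnj (v a) * g a + cnj t * g a * e a)"
    by (intro sum.cong) (auto simp: w_def e_def algebra_simps)
  also have "\<dots> = (\<Sum>a\<in>U. cnj (v a) * g a) + cnj t * g a0"
    by (simp only: sum.distrib e_sum)
  \<comment> \<open>The choice of \<open>t\<close> makes the \<open>a0\<close> component of
    \<open>M\<close> applied to \<open>w\<close> vanish.\<close>
  also have "g a0 = 0" using d by (simp add: g_def assms(4) t_def flip: L_def)
  also have "(\<Sum>a\<in>U. cnj (v a) * g a) = (\<Sum>a\<in>U. cnj (v a) * (\<Sum>b\<in>U. M a b * v b)) + t * cnj L"
    by (simp add: g_def L' distrib_left sum.distrib sum_distrib_left[of t] mult_ac)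
  finally have form_w: "(\<Sum>a\<in>U. \<Sum>b\<in>U. cnj (w a) * M a b * w b)
      = (\<Sum>a\<in>U. cnj (v a) * (\<Sum>b\<in>U. M a b * v b)) - cnj L * L / d"
    by (simp add: t_def)
  have "(\<Sum>a\<in>U. \<Sum>b\<in>U. cnj (v a) * (M a b - M a a0 * M a0 b / d) * v b)
     = (\<Sum>a\<in>U. cnj (v a) * (\<Sum>b\<in>U. M a b * v b)) - (\<Sum>a\<in>U. cnj (v a) * M a a0) * (\<Sum>b\<in>U. M a0 b * v b) / d"
    by (simp add: sum_product sum_divide_distrib sum_distrib_left sum_subtractf
        left_diff_distrib right_diff_distrib mult_ac)
  also have "\<dots> = (\<Sum>a\<in>U. \<Sum>b\<in>U. cnj (w a) * M a b * w b)"
    by (simp add: form_w L') (simp add: L_def)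
  finally show "(\<Sum>a\<in>U. \<Sum>b\<in>U. cnj (v a) * (M a b - M a a0 * M a0 b / d) * v b) \<in> \<real>\<^sub>\<ge>\<^sub>0"
    using psd[unfolded psd_on_def, rule_format, of w] by (simp only:)
qed

lemma psd_on_sum_rank_one:
  assumes "finite U" and "psd_on U M"
  shows "\<exists>(r::nat) v. \<forall>a\<in>U. \<forall>b\<in>U. M a b = (\<Sum>i<r. v i a * cnj (v i b))"
proof -
  \<comment> \<open>Generalized for the induction: \<open>D\<close> contains every index whose
    diagonal entry may be nonzero, and each step removes one pivot from it.\<close>
  have "\<exists>(r::nat) v. \<forall>a\<in>U. \<forall>b\<in>U. M a b = (\<Sum>i<r. v i a * cnj (v i b))"
    if "finite D" "psd_on U M" "\<forall>a\<in>U - D. M a a = 0" "D \<subseteq> U" for D M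
    using that
  proof (induction D arbitrary: M)
    case empty
    then have "M a b = 0" if "a \<in> U" "b \<in> U" for a b
      using psd_on_diagonal_zero[OF _ assms(1) that] that by auto
    then show ?case by (intro exI[of _ 0]) auto
  next
    case (insert a0 D)
    have a0: "a0 \<in> U" using insert by auto
    show ?case
    proof (cases "M a0 a0 = 0")
      case True
      with insert show ?thesis by (intro insert.IH) auto
    next
      case False
      define d where "d = M a0 a0"
      let ?M = "\<lambda>a b. M a b - M a a0 * M a0 b / d"
      have "psd_on U ?M"
        using insert a0 False assms by (intro psd_on_schur_complement) (auto simp: d_def)
      \<comment> \<open>Zero diagonal entries survive the elimination, because each forces a zero in
        the pivot column.\<close>
      moreover have "?M a a = 0" if "a \<in> U - D" for a
      proof (cases "a = a0")
        case True
        then show ?thesis using False by (simp add: d_def)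
      next
        case False
        then have "M a a = 0" using that insert by auto
        moreover from this have "M a a0 = 0"
          using psd_on_diagonal_zero[OF insert.prems(1) assms(1) _ a0] that by auto
        ultimately show ?thesis by simp
      qed
      ultimately obtain r :: nat and v where
        v: "\<forall>a\<in>U. \<forall>b\<in>U. ?M a b = (\<Sum>i<r. v i a * cnj (v i b))"
        using insert.IH[of ?M] insert.prems by auto
      \<comment> \<open>The pivot is a nonnegative real; dividing its column by its root gives the
        vector of the removed rank-one kernel.\<close>
      define s where "s = complex_of_real (sqrt (Re d))"
      have "d = of_real (Re d)" "Re d \<ge> 0"
        using psd_on_diagonal[OF insert.prems(1) assms(1) a0]
        by (simp_all add: d_def complex_nonneg_Reals_iff complex_eq_iff)
      then have s: "s * cnj s = d"
        by (simp add: s_def flip: of_real_mult)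
      define w where "w = v(r := \<lambda>a. M a a0 / s)"
      have "M a b = (\<Sum>i<Suc r. w i a * cnj (w i b))" if "a \<in> U" "b \<in> U" for a b
      proof -
        have "M a0 b = cnj (M b a0)"
          using psd_on_hermitian[OF insert.prems(1) assms(1) that(2) a0] .
        then have "M a b = (\<Sum>i<r. v i a * cnj (v i b)) + M a a0 * cnj (M b a0) / d"
          using v that by (simp add: algebra_simps)
        then show ?thesis by (simp add: w_def s[symmetric])
      qed
      then show ?thesis by blast
    qed
  qed
  from this[OF assms] show ?thesis by auto
qed

lemma positive_operator_psd_on:
  assumes T: "positive_operator T" and S: "finite S"
  shows "psd_on S (\<lambda>a b. T (basis_ket b) a)"
  unfolding psd_on_def
proof
  fix v :: "'a \<Rightarrow> complex"
  define \<psi> where "\<psi> x = (if x \<in> S then v x else 0)" for x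
  have \<psi>: "\<psi> \<in> ell2" using S by (intro finite_support_ell2[of S]) (auto simp: \<psi>_def)
  have "braket \<psi> (T \<psi>) = (\<Sum>a\<in>S. cnj (\<psi> a) * T \<psi> a)"
    unfolding braket_def
    by (rule infsumI, rule has_sum_finite_neutralI[OF S]) (auto simp: \<psi>_def)
  also have "\<dots> = (\<Sum>a\<in>S. cnj (v a) * (\<Sum>b\<in>S. T (basis_ket b) a * v b))"
    using T S bounded_operator_finite_support[of T S v]
    by (simp add: positive_operator_def \<psi>_def[abs_def])
  also have "\<dots> = (\<Sum>a\<in>S. \<Sum>b\<in>S. cnj (v a) * T (basis_ket b) a * v b)"
    by (simp add: sum_distrib_left mult.assoc)
  finally show "(\<Sum>a\<in>S. \<Sum>b\<in>S. cnj (v a) * T (basis_ket b) a * v b) \<in> \<real>\<^sub>\<ge>\<^sub>0"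
    using T \<psi> by (auto simp: positive_operator_def)
qed

section \<open>Stellar rank of finitely supported operators\<close>

lemma finite_multi_indices: "finite {k :: 'p::finite \<Rightarrow> nat. (\<Sum>i\<in>UNIV. k i) \<le> K}"
proof (rule finite_subset)
  show "{k :: 'p \<Rightarrow> nat. (\<Sum>i\<in>UNIV. k i) \<le> K} \<subseteq> PiE UNIV (\<lambda>_. {..K})"
  proof
    fix k :: "'p \<Rightarrow> nat"
    assume "k \<in> {k. (\<Sum>i\<in>UNIV. k i) \<le> K}"
    moreover have "k i \<le> (\<Sum>i\<in>UNIV. k i)" for i
      by (rule member_le_sum) auto
    ultimately show "k \<in> PiE UNIV (\<lambda>_. {..K})"
      by (auto intro: order_trans)
  qed
qed (simp add: finite_PiE)

text \<open>A finitely supported vector has a polynomial stellar function with coefficients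
  \<open>\<phi> k / sqrt_fact k\<close>. The Gaussian factor is trivial, and the infimum needs only
  this one factorization.\<close>

lemma pure_stellar_rank_le:
  fixes \<phi> :: "('p::finite \<Rightarrow> nat) \<Rightarrow> complex"
  assumes "finite U" and supp: "\<And>k. k \<notin> U \<Longrightarrow> \<phi> k = 0"
    and deg: "\<And>k. k \<in> U \<Longrightarrow> (\<Sum>i\<in>UNIV. k i) \<le> K"
  shows "pure_stellar_rank \<phi> \<le> enat K"
proof -
  define P where "P = Abs_poly_mapping (\<lambda>k. \<phi> k / sqrt_fact k)"
  have "finite {k. \<phi> k / sqrt_fact k \<noteq> 0}"
    by (rule finite_subset[OF _ \<open>finite U\<close>]) (use supp in auto)
  then have lookup: "Poly_Mapping.lookup P = (\<lambda>k. \<phi> k / sqrt_fact k)"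
    unfolding P_def by (intro Abs_poly_mapping_inverse CollectI)
  then have "\<phi> k \<noteq> 0" if "k \<in> Poly_Mapping.keys P" for k
    using that by (auto simp: in_keys_iff)
  then have keys: "Poly_Mapping.keys P \<subseteq> U"
    using supp by blast
  have "bargmann_ket \<phi> z = poly_eval P z" for z
  proof -
    have "((\<lambda>k. cnj (coherent (vec_cnj z) k) * \<phi> k) has_sum
        (\<Sum>k\<in>U. cnj (coherent (vec_cnj z) k) * \<phi> k)) UNIV"
      by (rule has_sum_finite_neutralI[OF \<open>finite U\<close>]) (auto simp: supp)
    then have "bargmann_ket \<phi> z = of_real (exp ((norm z)\<^sup>2 / 2)) * (\<Sum>k\<in>U. coherent z k * \<phi> k)"
      by (simp add: bargmann_ket_def braket_def infsumI cnj_coherent_vec_cnj)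
    also have "\<dots> = (\<Sum>k\<in>U. (of_real (exp ((norm z)\<^sup>2 / 2)) * of_real (exp (- (norm z)\<^sup>2 / 2))) *
        (\<phi> k / sqrt_fact k * mpow z k))"
      by (simp add: coherent_eq_mpow sum_distrib_left mult_ac)
    also have "of_real (exp ((norm z)\<^sup>2 / 2)) * of_real (exp (- (norm z)\<^sup>2 / 2)) = (1 :: complex)"
      by (simp flip: of_real_mult exp_add)
    also have "(\<Sum>k\<in>U. 1 * (\<phi> k / sqrt_fact k * mpow z k)) = (\<Sum>k\<in>Poly_Mapping.keys P. Poly_Mapping.lookup P k * mpow z k)"
      using \<open>finite U\<close> keys by (intro sum.mono_neutral_cong_right) (auto simp: lookup in_keys_iff)
    finally show ?thesis by (simp add: poly_eval_def mpow_def)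
  qed
  moreover have "total_degree (0 :: 'p polynomial) \<le> 2" "poly_eval (0 :: 'p polynomial) z = 0" for z
    by (simp_all add: total_degree_def poly_eval_def)
  ultimately have "\<exists>Q. total_degree Q \<le> 2 \<and> (\<forall>z. bargmann_ket \<phi> z = poly_eval P z * exp (poly_eval Q z))"
    by (intro exI[of _ 0]) simp
  moreover have "total_degree P \<le> K"
    using keys deg by (auto simp: total_degree_def)
  ultimately show ?thesis
    unfolding pure_stellar_rank_def by (intro Inf_lower2[of "enat (total_degree P)"]) auto
qed

text \<open>The rank-one terms of the kernel, normalized, are pure states supported on
  \<open>U\<close>. Their squared norms are the weights, which sum to the trace.\<close>

lemma stellar_rank_le_finite_support:
  fixes \<sigma> :: "('p::finite \<Rightarrow> nat) operator"
  assumes U: "finite U" and deg: "\<And>k. k \<in> U \<Longrightarrow> (\<Sum>i\<in>UNIV. k i) \<le> K"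
    and psd: "psd_on U M" and tr: "(\<Sum>a\<in>U. M a a) = 1"
    and \<sigma>: "\<And>\<psi> x. \<psi> \<in> ell2 \<Longrightarrow> \<sigma> \<psi> x = (if x \<in> U then \<Sum>l\<in>U. M x l * \<psi> l else 0)"
  shows "stellar_rank \<sigma> \<le> enat K"
proof -
  obtain r :: nat and v where
    v: "\<forall>a\<in>U. \<forall>b\<in>U. M a b = (\<Sum>i<r. v i a * cnj (v i b))"
    using psd_on_sum_rank_one[OF U psd] by blast
  define w where "w i a = (if a \<in> U then v i a else 0)" for i a
  define q where "q i = (\<Sum>a\<in>U. (cmod (v i a))\<^sup>2)" for i
  define p where "p i = (if i < r then q i else 0)" for i
  \<comment> \<open>Where the weight is 0 any unit vector will do; the vacuum is taken, and such
    indices do not enter the supremum.\<close>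
  define \<phi> where "\<phi> i = (if 0 < p i then (\<lambda>a. w i a / of_real (sqrt (q i))) else basis_ket (\<lambda>_. 0))" for i
  have q_nonneg: "0 \<le> q i" for i by (simp add: q_def sum_nonneg)
  have p_nonneg: "0 \<le> p i" for i by (simp add: p_def q_nonneg)
  have "complex_of_real (\<Sum>i<r. q i) = (\<Sum>i<r. \<Sum>a\<in>U. v i a * cnj (v i a))"
    unfolding q_def of_real_sum complex_norm_square ..
  also have "\<dots> = (\<Sum>a\<in>U. M a a)"
    by (subst sum.swap) (simp add: v)
  finally have "(\<Sum>i<r. q i) = 1"
    unfolding tr by (metis of_real_eq_1_iff)
  then have p_sum: "(p has_sum 1) UNIV"
    by (intro has_sum_finite_neutralI[of "{..<r}"]) (auto simp: p_def)
  have \<phi>_unit: "\<phi> i \<in> ell2 \<and> ell2_norm (\<phi> i) = 1" for i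
  proof (cases "0 < p i")
    case True
    then have "i < r" "0 < q i" by (auto simp: p_def split: if_splits)
    have "\<phi> i \<in> ell2"
      by (rule finite_support_ell2[OF U]) (simp add: True \<phi>_def w_def)
    moreover have "((\<lambda>a. (cmod (\<phi> i a))\<^sup>2) has_sum 1) UNIV"
    proof (rule has_sum_finite_neutralI[OF U])
      have "(\<Sum>a\<in>U. (cmod (\<phi> i a))\<^sup>2) = (\<Sum>a\<in>U. (cmod (v i a))\<^sup>2 / q i)"
        using True \<open>0 < q i\<close> by (intro sum.cong) (auto simp: \<phi>_def w_def norm_divide power_divide)
      also have "\<dots> = 1"
        using \<open>0 < q i\<close> by (simp add: q_def flip: sum_divide_distrib)
      finally show "1 = (\<Sum>a\<in>U. (cmod (\<phi> i a))\<^sup>2)" ..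
    qed (auto simp: \<phi>_def w_def True)
    ultimately show ?thesis by (simp add: ell2_norm_def infsumI)
  qed (simp add: \<phi>_def basis_ket_ell2 ell2_norm_basis_ket)
  have rank_one: "of_real (p i) * braket (\<phi> i) \<psi> * \<phi> i x = (\<Sum>l\<in>U. w i x * cnj (v i l) * \<psi> l)"
    if "i < r" for i \<psi> x
  proof (cases "0 < p i")
    case True
    with that have q: "0 < q i" by (simp add: p_def)
    have "braket (\<phi> i) \<psi> = (\<Sum>l\<in>U. cnj (\<phi> i l) * \<psi> l)"
      unfolding braket_def
      by (rule infsumI, rule has_sum_finite_neutralI[OF U]) (auto simp: True \<phi>_def w_def)
    also have "\<dots> = (\<Sum>l\<in>U. cnj (v i l) * \<psi> l) / of_real (sqrt (q i))"
      by (simp add: True \<phi>_def w_def sum_divide_distrib)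
    finally have "of_real (p i) * braket (\<phi> i) \<psi> * \<phi> i x
        = of_real (q i) / (of_real (sqrt (q i)) * of_real (sqrt (q i)))
          * ((\<Sum>l\<in>U. cnj (v i l) * \<psi> l) * w i x)"
      using that q by (simp add: True \<phi>_def p_def)
    also have "of_real (q i) / (of_real (sqrt (q i)) * of_real (sqrt (q i))) = (1 :: complex)"
      using q by (simp flip: of_real_mult)
    finally show ?thesis by (simp add: sum_distrib_left sum_distrib_right mult_ac)
  next
    case False
    \<comment> \<open>A vanishing weight means a vanishing vector on \<open>U\<close>, so both sides
      are 0.\<close>
    then have "q i = 0" using q_nonneg[of i] that by (simp add: p_def)
    then have "v i a = 0" if "a \<in> U" for a
      using U that by (simp add: q_def sum_nonneg_eq_0_iff)
    then show ?thesis using False p_nonneg[of i] by (simp add: w_def)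
  qed
  have "((\<lambda>i. of_real (p i) * braket (\<phi> i) \<psi> * \<phi> i x) has_sum \<sigma> \<psi> x) UNIV"
    if "\<psi> \<in> ell2" for \<psi> x
  proof (rule has_sum_finite_neutralI[of "{..<r}"])
    have "(\<Sum>i<r. of_real (p i) * braket (\<phi> i) \<psi> * \<phi> i x) = (\<Sum>l\<in>U. (\<Sum>i<r. w i x * cnj (v i l)) * \<psi> l)"
      by (simp add: rank_one sum.swap[of _ U] sum_distrib_right)
    also have "\<dots> = \<sigma> \<psi> x"
      unfolding \<sigma>[OF that] by (auto simp: v w_def)
    finally show "\<sigma> \<psi> x = (\<Sum>i<r. of_real (p i) * braket (\<phi> i) \<psi> * \<phi> i x)" ..
  qed (auto simp: p_def)
  then have "pure_decomposition \<sigma> p \<phi>"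
    using p_nonneg p_sum \<phi>_unit by (auto simp: pure_decomposition_def)
  moreover have "pure_stellar_rank (\<phi> i) \<le> enat K" if "0 < p i" for i
    using that deg by (intro pure_stellar_rank_le[OF U]) (auto simp: \<phi>_def w_def)
  then have "Sup {pure_stellar_rank (\<phi> i) | i. 0 < p i} \<le> enat K"
    by (auto intro: Sup_least)
  ultimately show ?thesis
    unfolding stellar_rank_def by (intro Inf_lower2) auto
qed

section \<open>Gaussian core states\<close>

lemma append_fock_basis_ket: "append_fock (basis_ket a) k = basis_ket (case_sum a k)"
proof
  fix x :: "'a + 'b \<Rightarrow> nat"
  have "x \<circ> Inl = a \<and> x \<circ> Inr = k \<longleftrightarrow> x = case_sum a k"
    by (auto simp: fun_eq_iff split: sum.split)
  then show "append_fock (basis_ket a) k x = basis_ket (case_sum a k) x"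
    by (auto simp: append_fock_def basis_ket_def)
qed

lemma post_select_basis_ket:
  "post_select k1 k2 \<rho> (basis_ket a') a = \<rho> (basis_ket (case_sum a' k2)) (case_sum a k1)"
  by (simp add: post_select_def append_fock_basis_ket)

text \<open>In the mode-wise ordering a Fock index of the bra occupies the \<open>Inr\<close> half of either block
  and one of the ket the \<open>Inl\<close> half.\<close>

lemma mpow_mode_wise:
  "mpow (mode_wise z w) \<kappa> = mpow z (\<kappa> \<circ> map_sum Inr Inr) * mpow w (\<kappa> \<circ> map_sum Inl Inl)"
  by (simp add: mpow_def prod_UNIV_sum mode_wise_def mult_ac)

lemma mode_wise_surj:
  obtains z w where "\<zeta> = mode_wise z w"
proof
  show "\<zeta> = mode_wise (\<chi> i. \<zeta> $ map_sum Inr Inr i) (\<chi> i. \<zeta> $ map_sum Inl Inl i)"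
    by (auto simp: mode_wise_def vec_eq_iff split: sum.split)
qed

text \<open>Turns the double series over bra and ket indices into one series over mode-wise
  multi-indices.\<close>

lemma bij_mode_wise_indices:
  "bij (\<lambda>\<kappa> :: ('m + 'm) + ('n + 'n) \<Rightarrow> nat. (\<kappa> \<circ> map_sum Inr Inr, \<kappa> \<circ> map_sum Inl Inl))"
proof (rule bij_betw_byWitness)
  let ?join = "\<lambda>(k :: 'm + 'n \<Rightarrow> nat, l :: 'm + 'n \<Rightarrow> nat).
    case_sum (case_sum (l \<circ> Inl) (k \<circ> Inl)) (case_sum (l \<circ> Inr) (k \<circ> Inr))"
  show "\<forall>\<kappa>\<in>UNIV. ?join (\<kappa> \<circ> map_sum Inr Inr, \<kappa> \<circ> map_sum Inl Inl) = \<kappa>"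
    by (simp add: fun_eq_iff split: sum.split)
  have "?join (k, l) \<circ> map_sum Inr Inr = k" "?join (k, l) \<circ> map_sum Inl Inl = l" for k l
    by (simp_all add: fun_eq_iff split_sum_all)
  then show "\<forall>p\<in>UNIV. (?join p \<circ> map_sum Inr Inr, ?join p \<circ> map_sum Inl Inl) = p"
    by auto
qed auto

text \<open>The Taylor coefficient of the Bargmann function at the monomial
  \<open>mpow \<zeta> \<kappa>\<close>; the denominators stem from the coherent states.\<close>

definition bargmann_coeff ::
    "('m::finite + 'n::finite \<Rightarrow> nat) operator \<Rightarrow> (('m + 'm) + ('n + 'n) \<Rightarrow> nat) \<Rightarrow> complex" where
  "bargmann_coeff \<rho> \<kappa> = \<rho> (basis_ket (\<kappa> \<circ> map_sum Inl Inl)) (\<kappa> \<circ> map_sum Inr Inr) /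
     (sqrt_fact (\<kappa> \<circ> map_sum Inr Inr) * sqrt_fact (\<kappa> \<circ> map_sum Inl Inl))"

lemma bargmann_coeff_case_sum:
  "bargmann_coeff \<rho> (case_sum (case_sum a' a) (case_sum k' k)) = 0 \<longleftrightarrow>
     \<rho> (basis_ket (case_sum a' k')) (case_sum a k) = 0"
proof -
  have "case_sum (case_sum a' a) (case_sum k' k) \<circ> map_sum Inr Inr = case_sum a k"
    "case_sum (case_sum a' a) (case_sum k' k) \<circ> map_sum Inl Inl = case_sum a' k'"
    by (auto simp: fun_eq_iff split: sum.split)
  then show ?thesis by (simp add: bargmann_coeff_def sqrt_fact_nonzero)
qed

lemma bargmann_series:
  assumes "bounded_operator \<rho>"
  shows "((\<lambda>\<kappa>. bargmann_coeff \<rho> \<kappa> * mpow (mode_wise z w) \<kappa>) has_sum bargmann_op \<rho> z w) UNIV"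
proof -
  have "((\<lambda>\<kappa>. (\<lambda>(k, l). \<rho> (basis_ket l) k * (mpow z k / sqrt_fact k) * (mpow w l / sqrt_fact l))
      (\<kappa> \<circ> map_sum Inr Inr, \<kappa> \<circ> map_sum Inl Inl)) has_sum bargmann_op \<rho> z w) UNIV"
    using bargmann_op_has_sum[OF assms]
    by (subst has_sum_reindex_bij_betw[OF bij_mode_wise_indices])
  then show ?thesis by (simp add: bargmann_coeff_def mpow_mode_wise mult_ac)
qed

lemma gaussian_series:
  assumes "bounded_operator \<rho>" and "is_Ab_parameters \<rho> A b"
  obtains C where
    "\<And>\<zeta>. ((\<lambda>\<kappa>. bargmann_coeff \<rho> \<kappa> * mpow \<zeta> \<kappa>) has_sum C * exp (gauss_exponent A b \<zeta>)) UNIV"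
proof -
  obtain C where C: "\<And>z w. bargmann_op \<rho> z w = C * exp (gauss_exponent A b (mode_wise z w))"
    using assms(2) unfolding is_Ab_parameters_def gauss_exponent_def by blast
  have "((\<lambda>\<kappa>. bargmann_coeff \<rho> \<kappa> * mpow \<zeta> \<kappa>) has_sum C * exp (gauss_exponent A b \<zeta>)) UNIV" for \<zeta>
    using bargmann_series[OF assms(1)] C by (cases rule: mode_wise_surj[of \<zeta>]) metis
  then show ?thesis by (rule that)
qed

text \<open>The Fock indices of M make up the degree in the \<open>Inl\<close> block and those of N
  the degree in the \<open>Inr\<close> block, so this is \<open>gauss_coeff_zero\<close> in terms of
  photon numbers.\<close>

lemma matrix_element_zero_if_gauss_blocks_zero:
  assumes "bounded_operator \<rho>" and "is_Ab_parameters \<rho> A b"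
    and "\<And>i j. A $ Inl i $ Inl j = 0" and "\<And>i. b $ Inl i = 0"
    and deg: "(\<Sum>j\<in>UNIV. k1 j) + (\<Sum>j\<in>UNIV. k2 j) < (\<Sum>i\<in>UNIV. a i) + (\<Sum>i\<in>UNIV. a' i)"
  shows "\<rho> (basis_ket (case_sum a' k2)) (case_sum a k1) = 0"
proof -
  obtain C where
    "\<And>\<zeta>. ((\<lambda>\<kappa>. bargmann_coeff \<rho> \<kappa> * mpow \<zeta> \<kappa>) has_sum C * exp (gauss_exponent A b \<zeta>)) UNIV"
    using gaussian_series[OF assms(1,2)] by blast
  then have "bargmann_coeff \<rho> (case_sum (case_sum a' a) (case_sum k2 k1)) = 0"
    by (rule gauss_coeff_zero[OF assms(3,4)])
      (use deg in \<open>simp_all add: deg_Inl_def deg_Inr_def sum_UNIV_sum\<close>)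
  then show ?thesis by (simp add: bargmann_coeff_case_sum)
qed

lemma density_operator_bounded: "density_operator \<rho> \<Longrightarrow> bounded_operator \<rho>"
  by (simp add: density_operator_def positive_operator_def)

text \<open>The vacuum on both sides of N picks out the monomials without \<open>Inr\<close>
  exponents, so finite Fock support becomes the finiteness that \<open>gauss_block_zero\<close> asks
  for.\<close>

lemma gauss_blocks_zero_if_core:
  assumes "gaussian_core_state \<rho>" and Ab: "is_Ab_parameters \<rho> A b"
  shows "A $ Inl i $ Inl j = 0" and "b $ Inl i = 0"
proof -
  have \<rho>: "density_operator \<rho>"
    using assms by (simp add: gaussian_core_state_def gaussian_state_def)
  obtain C where series:
    "\<And>\<zeta>. ((\<lambda>\<kappa>. bargmann_coeff \<rho> \<kappa> * mpow \<zeta> \<kappa>) has_sum C * exp (gauss_exponent A b \<zeta>)) UNIV"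
    using gaussian_series[OF density_operator_bounded[OF \<rho>] Ab] by blast
  \<comment> \<open>A zero prefactor would annihilate every matrix element, in contradiction to the
    unit trace.\<close>
  have "C \<noteq> 0"
  proof
    assume "C = 0"
    with series have "bargmann_coeff \<rho> \<kappa> = 0" for \<kappa>
      by (intro multivariate_power_series_zero) simp
    then have "\<rho> (basis_ket (case_sum a k)) (case_sum a k) = 0" for a k
      using bargmann_coeff_case_sum[of \<rho> a a k k] by simp
    then have "\<rho> (basis_ket x) x = 0" for x
      by (metis surjective_sum)
    then show False
      using \<rho> has_sum_unique[OF has_sum_0] by (fastforce simp: density_operator_def braket_basis_ket)
  qed
  define emb where "emb = (\<lambda>(a :: 'a \<Rightarrow> nat, a' :: 'a \<Rightarrow> nat).
    case_sum (case_sum a' a) (case_sum (\<lambda>_ :: 'b. 0 :: nat) (\<lambda>_ :: 'b. 0 :: nat)))"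
  have "{\<kappa>. deg_Inr \<kappa> = 0 \<and> bargmann_coeff \<rho> \<kappa> \<noteq> 0}
      \<subseteq> emb ` {(a, a'). braket (basis_ket a) (post_select (\<lambda>_. 0) (\<lambda>_. 0) \<rho> (basis_ket a')) \<noteq> 0}"
  proof
    fix \<kappa> :: "('a + 'a) + ('b + 'b) \<Rightarrow> nat"
    assume \<kappa>: "\<kappa> \<in> {\<kappa>. deg_Inr \<kappa> = 0 \<and> bargmann_coeff \<rho> \<kappa> \<noteq> 0}"
    then have "\<kappa> (Inr j) = 0" for j by (auto simp: deg_Inr_def)
    then have eq: "\<kappa> = emb (\<kappa> \<circ> Inl \<circ> Inr, \<kappa> \<circ> Inl \<circ> Inl)"
      by (auto simp: emb_def fun_eq_iff split: sum.split)
    with \<kappa> have "bargmann_coeff \<rho> (emb (\<kappa> \<circ> Inl \<circ> Inr, \<kappa> \<circ> Inl \<circ> Inl)) \<noteq> 0"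
      by simp
    then have "braket (basis_ket (\<kappa> \<circ> Inl \<circ> Inr)) (post_select (\<lambda>_. 0) (\<lambda>_. 0) \<rho> (basis_ket (\<kappa> \<circ> Inl \<circ> Inl))) \<noteq> 0"
      unfolding emb_def prod.case bargmann_coeff_case_sum braket_basis_ket post_select_basis_ket .
    with eq show "\<kappa> \<in> emb ` {(a, a'). braket (basis_ket a) (post_select (\<lambda>_. 0) (\<lambda>_. 0) \<rho> (basis_ket a')) \<noteq> 0}"
      by blast
  qed
  moreover have "finite_fock_support (post_select (\<lambda>_. 0) (\<lambda>_. 0) \<rho>)"
    using assms by (simp add: gaussian_core_state_def)
  ultimately have "finite {\<kappa>. deg_Inr \<kappa> = 0 \<and> bargmann_coeff \<rho> \<kappa> \<noteq> 0}"
    unfolding finite_fock_support_def by (blast intro: finite_subset)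
  moreover have "transpose A = A" using Ab by (simp add: is_Ab_parameters_def)
  ultimately show "A $ Inl i $ Inl j = 0" and "b $ Inl i = 0"
    using gauss_block_zero[OF _ series \<open>C \<noteq> 0\<close>] by auto
qed

text \<open>The vector \<open>append_fock \<psi> k\<close> is supported on the indices whose N part
  is \<open>k\<close>, so both its square summability and the coordinate expansion restrict to that
  range.\<close>

lemma post_select_expansion:
  assumes T: "bounded_operator \<rho>" and \<psi>: "\<psi> \<in> ell2"
  shows "((\<lambda>l. \<rho> (basis_ket (case_sum l k)) (case_sum a k) * \<psi> l) has_sum post_select k k \<rho> \<psi> a) UNIV"
proof -
  have inj: "inj (\<lambda>l. case_sum l k)"
    by (metis case_sum_o_inj(1) injI)
  have app: "append_fock \<psi> k (case_sum l k) = \<psi> l" for l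
    by (simp add: append_fock_def basis_ket_def case_sum_o_inj)
  have zero: "append_fock \<psi> k x = 0" if "x \<notin> range (\<lambda>l. case_sum l k)" for x
  proof -
    have "x = case_sum (x \<circ> Inl) (x \<circ> Inr)"
      by (simp add: fun_eq_iff split_sum_all)
    with that have "x \<circ> Inr \<noteq> k" by auto
    then show ?thesis by (simp add: append_fock_def basis_ket_def)
  qed
  have "((\<lambda>l. (cmod (append_fock \<psi> k (case_sum l k)))\<^sup>2) summable_on UNIV)"
    using \<psi> by (simp add: app ell2_def)
  then have "(\<lambda>x. (cmod (append_fock \<psi> k x))\<^sup>2) summable_on range (\<lambda>l. case_sum l k)"
    by (simp add: summable_on_reindex[OF inj] o_def)
  then have "append_fock \<psi> k \<in> ell2"
    unfolding ell2_def mem_Collect_eq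
    by (rule summable_on_cong_neutral[THEN iffD1, rotated -1]) (auto simp: zero)
  from bounded_operator_coordinate[OF T this, of "case_sum a k"]
  have "((\<lambda>x. \<rho> (basis_ket x) (case_sum a k) * append_fock \<psi> k x) has_sum post_select k k \<rho> \<psi> a)
      (range (\<lambda>l. case_sum l k))"
    unfolding post_select_def
    by (rule has_sum_cong_neutral[THEN iffD1, rotated -1]) (auto simp: zero)
  then show ?thesis
    by (simp add: has_sum_reindex[OF inj] o_def app)
qed

text \<open>Off the diagonal, \<open>|a| + |a'| \<le> 2 |k|\<close> alone would allow
  \<open>|a|\<close> up to \<open>2 |k|\<close>. On the diagonal it reads
  \<open>|a| \<le> |k|\<close>, and positivity carries this over to whole rows and columns.\<close>

lemma stellar_rank_post_select_le:
  fixes \<rho> :: "('m::finite + 'n::finite \<Rightarrow> nat) operator"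
  assumes pos: "positive_operator \<rho>"
    and zero: "\<And>a a'. 2 * (\<Sum>j\<in>UNIV. k j) < (\<Sum>i\<in>UNIV. a i) + (\<Sum>i\<in>UNIV. a' i) \<Longrightarrow>
      \<rho> (basis_ket (case_sum a' k)) (case_sum a k) = 0"
    and nz: "\<psi>0 \<in> ell2" "post_select k k \<rho> \<psi>0 \<noteq> (\<lambda>a. 0)"
  shows "stellar_rank (normalized (post_select k k \<rho>)) \<le> enat (\<Sum>j\<in>UNIV. k j)"
proof -
  define K where "K = (\<Sum>j\<in>UNIV. k j)"
  define U where "U = {a :: 'm \<Rightarrow> nat. (\<Sum>i\<in>UNIV. a i) \<le> K}"
  have U: "finite U" unfolding U_def by (rule finite_multi_indices)
  have T: "bounded_operator \<rho>" using pos by (simp add: positive_operator_def)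
  define N where "N a b = \<rho> (basis_ket (case_sum b k)) (case_sum a k)" for a b
  have psd: "psd_on S N" if "finite S" for S
  proof -
    have inj: "inj_on (\<lambda>l. case_sum l k) S"
      by (metis case_sum_o_inj(1) inj_onI)
    have "psd_on ((\<lambda>l. case_sum l k) ` S) (\<lambda>a b. \<rho> (basis_ket b) a)"
      using that by (intro positive_operator_psd_on pos) auto
    from this[unfolded psd_on_def, rule_format, of "\<lambda>x. v (x \<circ> Inl)" for v]
    show ?thesis
      by (simp add: psd_on_def N_def sum.reindex[OF inj] o_def case_sum_o_inj)
  qed
  have off: "N a b = 0" if "a \<notin> U \<or> b \<notin> U" for a b
  proof -
    have diag: "N c c = 0" if "c \<notin> U" for c
      unfolding N_def by (rule zero) (use that in \<open>simp add: U_def K_def\<close>)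
    show ?thesis
      using that psd_on_diagonal_zero[OF psd[of "{a, b}"]] diag by blast
  qed
  have expand: "post_select k k \<rho> \<psi> x = (if x \<in> U then \<Sum>l\<in>U. N x l * \<psi> l else 0)"
    if "\<psi> \<in> ell2" for \<psi> x
  proof -
    have "((\<lambda>l. N x l * \<psi> l) has_sum (\<Sum>l\<in>U. N x l * \<psi> l)) UNIV"
      by (rule has_sum_finite_neutralI[OF U]) (auto simp: off)
    moreover have "((\<lambda>l. N x l * \<psi> l) has_sum post_select k k \<rho> \<psi> x) UNIV"
      unfolding N_def by (rule post_select_expansion[OF T that])
    ultimately have "post_select k k \<rho> \<psi> x = (\<Sum>l\<in>U. N x l * \<psi> l)"
      using has_sum_unique by blast
    then show ?thesis by (simp add: off)
  qed
  define t where "t = (\<Sum>a\<in>U. N a a)"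
  have op_trace: "op_trace (post_select k k \<rho>) = t"
    unfolding op_trace_def t_def braket_basis_ket post_select_basis_ket N_def[symmetric]
    by (rule infsumI, rule has_sum_finite_neutralI[OF U]) (auto simp: off)
  have diag: "N a a = of_real (Re (N a a)) \<and> 0 \<le> Re (N a a)" if "a \<in> U" for a
    using psd_on_diagonal[OF psd[OF U] U that] by (simp add: complex_nonneg_Reals_iff complex_eq_iff)
  have t_real: "t = of_real (\<Sum>a\<in>U. Re (N a a))"
    unfolding t_def of_real_sum using diag by (intro sum.cong) auto
  \<comment> \<open>A positive kernel of trace 0 vanishes, which \<open>\<psi>0\<close> rules out;
    so the normalization divides by a nonzero number.\<close>
  have "t \<noteq> 0"
  proof
    assume "t = 0"
    then have "(\<Sum>a\<in>U. Re (N a a)) = 0"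
      unfolding t_real by (simp only: of_real_eq_0_iff)
    then have "N a a = 0" if "a \<in> U" for a
      using sum_nonneg_eq_0_iff[OF U, of "\<lambda>a. Re (N a a)"] diag that by (metis of_real_0)
    then have "N a b = 0" if "a \<in> U" "b \<in> U" for a b
      using psd_on_diagonal_zero[OF psd[OF U] U that] that by blast
    then have "post_select k k \<rho> \<psi>0 = (\<lambda>a. 0)"
      by (auto simp: expand[OF nz(1)])
    with nz(2) show False by simp
  qed
  define s where "s = (\<Sum>a\<in>U. Re (N a a))"
  have "t = of_real s" by (simp only: t_real s_def)
  moreover have "0 \<le> s" unfolding s_def using diag by (intro sum_nonneg) auto
  ultimately have s: "0 < s" "t = of_real s"
    using \<open>t \<noteq> 0\<close> by (auto simp: order_less_le)
  have "psd_on U (\<lambda>a b. N a b / t)"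
    unfolding psd_on_def
  proof
    fix v
    have "(\<Sum>a\<in>U. \<Sum>b\<in>U. cnj (v a) * (N a b / t) * v b) = of_real (1 / s) * (\<Sum>a\<in>U. \<Sum>b\<in>U. cnj (v a) * N a b * v b)"
      by (simp add: s sum_distrib_left)
    also have "\<dots> \<in> \<real>\<^sub>\<ge>\<^sub>0"
      using psd[OF U] s by (intro nonneg_Reals_mult_I) (auto simp: psd_on_def)
    finally show "(\<Sum>a\<in>U. \<Sum>b\<in>U. cnj (v a) * (N a b / t) * v b) \<in> \<real>\<^sub>\<ge>\<^sub>0" .
  qed
  moreover have "(\<Sum>a\<in>U. N a a / t) = 1"
    using \<open>t \<noteq> 0\<close> by (simp add: t_def flip: sum_divide_distrib)
  moreover have "normalized (post_select k k \<rho>) \<psi> x = (if x \<in> U then \<Sum>l\<in>U. N x l / t * \<psi> l else 0)"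
    if "\<psi> \<in> ell2" for \<psi> x
    by (simp add: normalized_def op_trace expand[OF that] sum_divide_distrib)
  ultimately show ?thesis
    unfolding K_def[symmetric]
    by (intro stellar_rank_le_finite_support[OF U, where M = "\<lambda>a b. N a b / t"]) (simp_all add: U_def)
qed

theorem proposition1:
  fixes \<rho> :: "('m::finite + 'n::finite \<Rightarrow> nat) operator"
    and A :: "complex ^ (('m + 'm) + ('n + 'n)) ^ (('m + 'm) + ('n + 'n))"
    and b :: "complex ^ (('m + 'm) + ('n + 'n))"
  assumes "gaussian_state \<rho>" and "is_Ab_parameters \<rho> A b"
  shows "(gaussian_core_state \<rho> \<longleftrightarrow>
            (\<forall>i j. A $ Inl i $ Inl j = 0) \<and> (\<forall>i. b $ Inl i = 0)) \<and>
         (gaussian_core_state \<rho> \<longrightarrow>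
            (\<forall>k. (\<exists>\<psi>\<in>ell2. post_select k k \<rho> \<psi> \<noteq> (\<lambda>a. 0)) \<longrightarrow>
               stellar_rank (normalized (post_select k k \<rho>)) \<le> enat (\<Sum>j\<in>UNIV. k j)))"
proof -
  have pos: "positive_operator \<rho>" and bdd: "bounded_operator \<rho>"
    using assms(1) by (auto simp: gaussian_state_def density_operator_def positive_operator_def)
  have core: "gaussian_core_state \<rho>"
    if blocks: "\<And>i j. A $ Inl i $ Inl j = 0" "\<And>i. b $ Inl i = 0"
  proof -
    have "finite_fock_support (post_select k1 k2 \<rho>)" for k1 k2
    proof -
      \<comment> \<open>The degree bound controls \<open>|a| + |a'|\<close>, hence each of the two
        separately.\<close>
      define K where "K = (\<Sum>j\<in>UNIV. k1 j) + (\<Sum>j\<in>UNIV. k2 j)"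
      let ?V = "{a :: 'm \<Rightarrow> nat. (\<Sum>i\<in>UNIV. a i) \<le> K}"
      have "{(a, a'). braket (basis_ket a) (post_select k1 k2 \<rho> (basis_ket a')) \<noteq> 0} \<subseteq> ?V \<times> ?V"
      proof (clarsimp simp: braket_basis_ket post_select_basis_ket)
        fix a a' :: "'m \<Rightarrow> nat"
        assume "\<rho> (basis_ket (case_sum a' k2)) (case_sum a k1) \<noteq> 0"
        then have "(\<Sum>i\<in>UNIV. a i) + (\<Sum>i\<in>UNIV. a' i) \<le> K"
          using matrix_element_zero_if_gauss_blocks_zero[OF bdd assms(2) blocks, of k1 k2 a a']
          by (force simp: K_def)
        then show "(\<Sum>i\<in>UNIV. a i) \<le> K \<and> (\<Sum>i\<in>UNIV. a' i) \<le> K" by simp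
      qed
      then show ?thesis
        unfolding finite_fock_support_def
        by (rule finite_subset) (simp add: finite_multi_indices)
    qed
    then show ?thesis using assms(1) by (simp add: gaussian_core_state_def)
  qed
  \<comment> \<open>For \<open>k1 = k2 = k\<close> the degree bound is \<open>2 |k|\<close>, as
    \<open>stellar_rank_post_select_le\<close> requires.\<close>
  have rank: "stellar_rank (normalized (post_select k k \<rho>)) \<le> enat (\<Sum>j\<in>UNIV. k j)"
    if "gaussian_core_state \<rho>" "\<psi> \<in> ell2" "post_select k k \<rho> \<psi> \<noteq> (\<lambda>a. 0)" for k \<psi>
    by (rule stellar_rank_post_select_le[OF pos _ that(2,3)])
      (rule matrix_element_zero_if_gauss_blocks_zero[OF bdd assms(2)],
       simp_all add: gauss_blocks_zero_if_core[OF that(1) assms(2)])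
  show ?thesis
    using core rank gauss_blocks_zero_if_core[OF _ assms(2)] by blast
qed

end
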